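(* Let $n_1,n_2\ge 1$ and $m_1,m_2\ge 0$ be integers and let $X=(\mathbb{Z}_{n_1},c_{m_1})\vee (\mathbb{Z}_{n_2},c_{m_2})$. For $i\in\{1,2\}$ consider the conditions (a$_i$) $3\le 3m_i<n_i$; (b$_i$) $\left\lfloor\frac{n_i}{2}\right\rfloor\le m_i$, or ($n_i=3$ and $1\le m_i$). Then \[H_1(X)\cong\begin{cases} \mathbb{Z}\oplus \mathbb{Z},& \text{if (a}_1\text{) and (a}_2\text{) hold},\\ \mathbb{Z},& \text{if (a}_i\text{) and (b}_j\text{) hold for some } \{i,j\}=\{1,2\},\\ 0,& \text{if (b}_1\text{) and (b}_2\text{) hold}. \end{cases}\]
   Context: A (Čech) closure space is a pair $(X,c)$ of a set $X$ and a function $c:2^X\to 2^X$ with $c(\varnothing)=\varnothing$, $A\subset c(A)$, and $c(A\cup B)=c(A)\cup c(B)$ for all $A,B\subset X$. Topological spaces are the closure spaces with $c(c(A))=c(A)$ for all $A$, where $c$ is the topological closure. A map $f:(X,c)\to(Y,d)$ is continuous if $f(c(A))\subset d(f(A))$ for all $A\subset X$. $\mathbb{Z}_n=\{0,1,\dots,n-1\}$ with metric $d(i,j)=\min\{|k| : k\equiv i-j \bmod n\}$. For $m\ge 0$, $c_m(i)=\{j\in\mathbb{Z}_n : d(i,j)\le m\}$ and $c_m(A)=\bigcup_{i\in A}c_m(i)$ for $A\subset\mathbb{Z}_n$. The wedge sum $(X_1,c_1)\vee(X_2,c_2)$ is the quotient of the disjoint union $X_1\sqcup X_2$, with closure $c(A_1\sqcup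 A_2)=c_1(A_1)\sqcup c_2(A_2)$, by the identification of chosen basepoints $x_1\in X_1$, $x_2\in X_2$; with quotient map $q$, its closure is $A\mapsto q(c(q^{-1}(A)))$. Singular homology: let $|\Delta^n|=\{(t_0,\dots,t_n)\in\mathbb{R}^{n+1} : \sum_i t_i=1,\ t_i\ge 0\}=[e_0,\dots,e_n]$ with the Euclidean topology. $C_n(X)$ is the free abelian group on continuous maps $\sigma:|\Delta^n|\to X$ (and $C_n(X)=0$ for $n<0$), $\partial_n(\sigma)=\sum_{i=0}^n(-1)^i\sigma|_{[e_0,\dots,\hat e_i,\dots,e_n]}$, and $H_n(X)=\ker\partial_n/\operatorname{im}\partial_{n+1}$. *)

theory Defs
  imports "HOL-Homology.Homology" "HOL-Number_Theory.Cong"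
begin

section \<open>Closure spaces\<close>

text \<open>A closure space is a pair of a carrier set and a closure operator; the operator is only
  meaningful on subsets of the carrier.\<close>

type_synonym 'a cspace = "'a set \<times> ('a set \<Rightarrow> 'a set)"

definition closure_space :: "'a cspace \<Rightarrow> bool" where
  "closure_space = (\<lambda>(X, c).
     (\<forall>A. A \<subseteq> X \<longrightarrow> c A \<subseteq> X) \<and>
     c {} = {} \<and>
     (\<forall>A. A \<subseteq> X \<longrightarrow> A \<subseteq> c A) \<and>
     (\<forall>A B. A \<subseteq> X \<longrightarrow> B \<subseteq> X \<longrightarrow> c (A \<union> B) = c A \<union> c B))"

definition cspace_continuous :: "'a cspace \<Rightarrow> 'b cspace \<Rightarrow> ('a \<Rightarrow> 'b) \<Rightarrow> bool" where
  "cspace_continuous = (\<lambda>(X, c) (Y, d) f.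
     f \<in> X \<rightarrow> Y \<and> (\<forall>A. A \<subseteq> X \<longrightarrow> f ` c A \<subseteq> d (f ` A)))"

definition cspace_of_topology :: "'a topology \<Rightarrow> 'a cspace" where
  "cspace_of_topology T = (topspace T, (closure_of) T)"

definition disjoint_union_cspace :: "'a cspace \<Rightarrow> 'b cspace \<Rightarrow> ('a + 'b) cspace" where
  "disjoint_union_cspace = (\<lambda>(X1, c1) (X2, c2).
     (Inl ` X1 \<union> Inr ` X2, \<lambda>A. Inl ` c1 (Inl -` A) \<union> Inr ` c2 (Inr -` A)))"

text \<open>The quotient by an equivalence relation \<open>r\<close> on the carrier: the quotient map is
  \<open>q x = r `` {x}\<close> and the closure operator is \<open>A \<mapsto> q (c (q\<^sup>-\<^sup>1 A))\<close>.\<close>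

definition quotient_cspace :: "'a cspace \<Rightarrow> ('a \<times> 'a) set \<Rightarrow> 'a set cspace" where
  "quotient_cspace = (\<lambda>(X, c) r.
     (let q = (\<lambda>x. r `` {x}) in (X // r, \<lambda>A. q ` c {x \<in> X. q x \<in> A})))"

definition wedge_rel :: "'a set \<Rightarrow> 'a \<Rightarrow> 'b set \<Rightarrow> 'b \<Rightarrow> (('a + 'b) \<times> ('a + 'b)) set" where
  "wedge_rel X1 x1 X2 x2 =
     Id_on (Inl ` X1 \<union> Inr ` X2) \<union> {(Inl x1, Inr x2), (Inr x2, Inl x1)}"

definition wedge_cspace :: "'a cspace \<Rightarrow> 'a \<Rightarrow> 'b cspace \<Rightarrow> 'b \<Rightarrow> ('a + 'b) set cspace" where
  "wedge_cspace S1 x1 S2 x2 =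
     quotient_cspace (disjoint_union_cspace S1 S2) (wedge_rel (fst S1) x1 (fst S2) x2)"


section \<open>The spaces $(\mathbb{Z}_n, c_m)$\<close>

definition Zn :: "nat \<Rightarrow> int set" where
  "Zn n = {0..<int n}"

definition Zn_dist :: "nat \<Rightarrow> int \<Rightarrow> int \<Rightarrow> nat" where
  "Zn_dist n i j = (LEAST d. \<exists>k. [k = i - j] (mod int n) \<and> d = nat \<bar>k\<bar>)"

definition Zn_closure :: "nat \<Rightarrow> nat \<Rightarrow> int set \<Rightarrow> int set" where
  "Zn_closure n m A = (\<Union>i\<in>A. {j \<in> Zn n. Zn_dist n i j \<le> m})"

definition Zn_cspace :: "nat \<Rightarrow> nat \<Rightarrow> int cspace" where
  "Zn_cspace n m = (Zn n, Zn_closure n m)"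


section \<open>Singular homology of closure spaces\<close>

text \<open>The simplex \<open>standard_simplex p\<close> consists of the functions \<open>nat \<Rightarrow> real\<close> vanishing beyond
  index \<open>p\<close>, so the subspace topology inherited from the product topology is the Euclidean one.
  As in HOL-Homology, maps are taken to be \<open>undefined\<close> off the simplex so that each map on the
  simplex is represented exactly once.\<close>

definition csimplex_space :: "nat \<Rightarrow> (nat \<Rightarrow> real) cspace" where
  "csimplex_space p = cspace_of_topology (subtopology (powertop_real UNIV) (standard_simplex p))"

definition csingular_simplex :: "nat \<Rightarrow> 'a cspace \<Rightarrow> ((nat \<Rightarrow> real) \<Rightarrow> 'a) \<Rightarrow> bool" where
  "csingular_simplex p S f \<longleftrightarrow>
     cspace_continuous (csimplex_space p) S f \<and> f \<in> extensional (standard_simplex p)"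

definition cchain_group :: "nat \<Rightarrow> 'a cspace \<Rightarrow> 'a chain monoid" where
  "cchain_group p S = free_Abelian_group (Collect (csingular_simplex p S))"

text \<open>The boundary operator \<open>chain_boundary\<close> of HOL-Homology is the alternating sum of faces and
  does not refer to a topology on the target; it is \<open>0\<close> in degree \<open>0\<close>.\<close>

definition ccycles :: "nat \<Rightarrow> 'a cspace \<Rightarrow> 'a chain set" where
  "ccycles p S = {z \<in> carrier (cchain_group p S). chain_boundary p z = 0}"

definition cboundaries :: "nat \<Rightarrow> 'a cspace \<Rightarrow> 'a chain set" where
  "cboundaries p S = chain_boundary (Suc p) ` carrier (cchain_group (Suc p) S)"

definition chomology_group :: "nat \<Rightarrow> 'a cspace \<Rightarrow> 'a chain set monoid" where
  "chomology_group p S =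
     subgroup_generated (cchain_group p S) (ccycles p S) Mod cboundaries p S"


section \<open>Well-definedness\<close>

lemma closure_space_of_topology: "closure_space (cspace_of_topology T)"
  by (auto simp: closure_space_def cspace_of_topology_def closure_of_Un
      dest: subsetD[OF closure_of_subset_topspace] intro: subsetD[OF closure_of_subset])

lemma cspace_continuous_of_topology:
  "cspace_continuous (cspace_of_topology T) (cspace_of_topology U) f \<longleftrightarrow> continuous_map T U f"
proof
  assume "continuous_map T U f"
  then show "cspace_continuous (cspace_of_topology T) (cspace_of_topology U) f"
    unfolding cspace_continuous_def cspace_of_topology_def prod.case
    by (simp add: continuous_map_image_closure_subset) (simp add: continuous_map_def)
next
  assume *: "cspace_continuous (cspace_of_topology T) (cspace_of_topology U) f"
  have "f ` (T closure_of A) \<subseteq> U closure_of f ` A" for A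
  proof -
    have "f ` (T closure_of (topspace T \<inter> A)) \<subseteq> U closure_of f ` (topspace T \<inter> A)"
      using * unfolding cspace_continuous_def cspace_of_topology_def prod.case by blast
    also have "\<dots> \<subseteq> U closure_of f ` A"
      by (intro closure_of_mono image_mono) auto
    finally show ?thesis
      by (metis closure_of_restrict)
  qed
  then show "continuous_map T U f"
    by (auto simp: continuous_map_eq_image_closure_subset)
qed

lemma closure_space_disjoint_union:
  assumes "closure_space S1" "closure_space S2"
  shows "closure_space (disjoint_union_cspace S1 S2)"
proof -
  obtain X1 c1 X2 c2 where S: "S1 = (X1, c1)" "S2 = (X2, c2)"
    by (metis surj_pair)
  let ?X = "Inl ` X1 \<union> Inr ` X2"
  let ?c = "\<lambda>A. Inl ` c1 (Inl -` A) \<union> Inr ` c2 (Inr -` A)"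
  have sub: "Inl -` A \<subseteq> X1" "Inr -` A \<subseteq> X2" if "A \<subseteq> ?X" for A
    using that by auto
  have c1: "c1 {} = {}" "\<And>A. A \<subseteq> X1 \<Longrightarrow> c1 A \<subseteq> X1" "\<And>A. A \<subseteq> X1 \<Longrightarrow> A \<subseteq> c1 A"
      "\<And>A B. A \<subseteq> X1 \<Longrightarrow> B \<subseteq> X1 \<Longrightarrow> c1 (A \<union> B) = c1 A \<union> c1 B"
    using assms(1) unfolding S closure_space_def by simp_all
  have c2: "c2 {} = {}" "\<And>A. A \<subseteq> X2 \<Longrightarrow> c2 A \<subseteq> X2" "\<And>A. A \<subseteq> X2 \<Longrightarrow> A \<subseteq> c2 A"
      "\<And>A B. A \<subseteq> X2 \<Longrightarrow> B \<subseteq> X2 \<Longrightarrow> c2 (A \<union> B) = c2 A \<union> c2 B"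
    using assms(2) unfolding S closure_space_def by simp_all
  have 1: "?c A \<subseteq> ?X" if "A \<subseteq> ?X" for A
    by (intro Un_mono image_mono c1(2) c2(2) sub[OF that])
  have 2: "A \<subseteq> ?c A" if "A \<subseteq> ?X" for A
  proof
    fix x assume "x \<in> A"
    then show "x \<in> ?c A"
      using c1(3)[OF sub(1)[OF that]] c2(3)[OF sub(2)[OF that]] by (cases x) auto
  qed
  have 3: "?c (A \<union> B) = ?c A \<union> ?c B" if "A \<subseteq> ?X" "B \<subseteq> ?X" for A B
    unfolding vimage_Un c1(4)[OF sub(1)[OF that(1)] sub(1)[OF that(2)]]
      c2(4)[OF sub(2)[OF that(1)] sub(2)[OF that(2)]] image_Un
    by (simp only: Un_ac)
  show ?thesis
    unfolding S closure_space_def disjoint_union_cspace_def prod.case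
    using 1 2 3 c1(1) c2(1) by (intro conjI allI impI) (assumption | simp only: vimage_empty image_empty Un_empty)+
qed

lemma closure_space_quotient:
  assumes "closure_space (X, c)"
  shows "closure_space (quotient_cspace (X, c) r)"
proof -
  let ?q = "\<lambda>x. r `` {x}"
  let ?p = "\<lambda>A. {x \<in> X. ?q x \<in> A}"
  have 1: "?q ` c (?p A) \<subseteq> X // r" for A
  proof -
    have "c (?p A) \<subseteq> X" using assms unfolding closure_space_def by auto
    then show ?thesis by (auto simp: quotient_def)
  qed
  have 2: "A \<subseteq> ?q ` c (?p A)" if A: "A \<subseteq> X // r" for A
  proof
    fix a assume a: "a \<in> A"
    then obtain x where x: "x \<in> X" "a = ?q x" using A by (meson quotientE subsetD)
    moreover have "?p A \<subseteq> c (?p A)" using assms unfolding closure_space_def by auto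
    ultimately show "a \<in> ?q ` c (?p A)" using a by blast
  qed
  have 3: "?q ` c (?p (A \<union> B)) = ?q ` c (?p A) \<union> ?q ` c (?p B)" for A B
  proof -
    have "?p (A \<union> B) = ?p A \<union> ?p B" by auto
    moreover have "c (?p A \<union> ?p B) = c (?p A) \<union> c (?p B)"
      using assms unfolding closure_space_def by auto
    ultimately show ?thesis by (simp add: image_Un)
  qed
  have 4: "c {} = {}"
    using assms unfolding closure_space_def by auto
  show ?thesis
    unfolding quotient_cspace_def closure_space_def Let_def prod.case
    using 1 2 3 4 by simp
qed

lemma equiv_wedge_rel:
  assumes "x1 \<in> X1" "x2 \<in> X2"
  shows "equiv (Inl ` X1 \<union> Inr ` X2) (wedge_rel X1 x1 X2 x2)"
  using assms unfolding wedge_rel_def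
  by (intro equivI) (auto simp: refl_on_def sym_def trans_def)

lemma closure_space_wedge:
  assumes "closure_space S1" "closure_space S2"
  shows "closure_space (wedge_cspace S1 x1 S2 x2)"
  unfolding wedge_cspace_def
  using closure_space_quotient closure_space_disjoint_union[OF assms] by (metis surj_pair)

lemma Zn_dist_attained:
  "\<exists>k. [k = i - j] (mod int n) \<and> Zn_dist n i j = nat \<bar>k\<bar>"
  unfolding Zn_dist_def
  by (rule LeastI_ex) (metis cong_refl)

lemma closure_space_Zn: "closure_space (Zn_cspace n m)"
proof -
  have "Zn_dist n i i = 0" for i
    unfolding Zn_dist_def by (rule Least_eq_0) (auto intro!: exI[of _ 0])
  then show ?thesis
    by (force simp: closure_space_def Zn_cspace_def Zn_closure_def)
qed

lemma chomology_group_of_topology: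
  "chomology_group p (cspace_of_topology T) = homology_group (int p) T"
proof -
  have s: "csingular_simplex q (cspace_of_topology T) = singular_simplex q T" for q
    by (auto simp: fun_eq_iff csingular_simplex_def singular_simplex_def csimplex_space_def
        cspace_continuous_of_topology)
  have g: "cchain_group q (cspace_of_topology T) = chain_group q T" for q
    by (simp add: cchain_group_def chain_group_def s)
  have z: "ccycles p (cspace_of_topology T) = singular_relcycle_set p T {}"
    by (auto simp: ccycles_def g singular_cycle)
  have b: "cboundaries p (cspace_of_topology T) = singular_relboundary_set p T {}"
    by (auto simp: cboundaries_def g singular_boundary)
  show ?thesis
    by (simp add: chomology_group_def g z b relative_homology_group_def relcycle_group_def)
qed

lemma csingular_simplex_face:
  assumes f: "csingular_simplex p S f" and "1 \<le> p" "k \<le> p"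
  shows "csingular_simplex (p - Suc 0) S (singular_face p k f)"
proof -
  obtain X c where S: "S = (X, c)" by fastforce
  let ?D = "\<lambda>p. subtopology (powertop_real UNIV) (standard_simplex p)"
  let ?s = "simplical_face k :: (nat \<Rightarrow> real) \<Rightarrow> nat \<Rightarrow> real"
  let ?f = "singular_face p k f"
  have "singular_simplex (p - Suc 0) (?D p) (singular_face p k (restrict id (standard_simplex p)))"
    by (rule singular_simplex_singular_face)
      (use assms in \<open>auto simp: singular_simplex_def intro: continuous_map_eq[OF continuous_map_id]\<close>)
  then have "continuous_map (?D (p - Suc 0)) (?D p)
      (singular_face p k (restrict id (standard_simplex p)))"
    by (simp add: singular_simplex_def)
  then have "continuous_map (?D (p - Suc 0)) (?D p) ?s"
    by (rule continuous_map_eq)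
      (use assms in \<open>auto simp: singular_face_def simplical_face_in_standard_simplex\<close>)
  then have s: "?s \<in> standard_simplex (p - Suc 0) \<rightarrow> standard_simplex p"
      "\<And>A. A \<subseteq> standard_simplex (p - Suc 0) \<Longrightarrow> ?s ` (?D (p - Suc 0) closure_of A) \<subseteq> ?D p closure_of (?s ` A)"
    using cspace_continuous_of_topology[of "?D (p - Suc 0)" "?D p" ?s]
    unfolding cspace_continuous_def cspace_of_topology_def by auto
  have fX: "f \<in> standard_simplex p \<rightarrow> X"
      "\<And>A. A \<subseteq> standard_simplex p \<Longrightarrow> f ` (?D p closure_of A) \<subseteq> c (f ` A)"
    using f unfolding csingular_simplex_def csimplex_space_def S
      cspace_continuous_def cspace_of_topology_def by auto
  have fs: "?f ` A = f ` ?s ` A" if "A \<subseteq> standard_simplex (p - Suc 0)" for A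
    using that by (force simp: singular_face_def image_iff)
  have "?f ` (?D (p - Suc 0) closure_of A) \<subseteq> c (?f ` A)" if A: "A \<subseteq> standard_simplex (p - Suc 0)" for A
  proof -
    have "?D (p - Suc 0) closure_of A \<subseteq> standard_simplex (p - Suc 0)"
      using closure_of_subset_topspace[of "?D (p - Suc 0)" A] by simp
    then have "?f ` (?D (p - Suc 0) closure_of A) = f ` ?s ` (?D (p - Suc 0) closure_of A)"
      by (rule fs)
    also have "\<dots> \<subseteq> f ` (?D p closure_of (?s ` A))"
      using s(2)[OF A] by blast
    also have "\<dots> \<subseteq> c (f ` ?s ` A)"
      by (rule fX(2)) (use A s(1) in auto)
    finally show ?thesis using fs[OF A] by simp
  qed
  moreover have "?f \<in> standard_simplex (p - Suc 0) \<rightarrow> X"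
    using s(1) fX(1) by (auto simp: singular_face_def)
  ultimately show ?thesis
    by (simp add: csingular_simplex_def csimplex_space_def S cspace_continuous_def
        cspace_of_topology_def singular_face_def)
qed

lemma chain_boundary_cchain_group:
  assumes "z \<in> carrier (cchain_group p S)"
  shows "chain_boundary p z \<in> carrier (cchain_group (p - Suc 0) S)"
proof (cases "p = 0")
  case False
  let ?G = "cchain_group (p - Suc 0) S"
  have *: "frag_cmul ((-1) ^ k) (frag_of (singular_face p k f)) \<in> carrier ?G"
    if "f \<in> Poly_Mapping.keys z" "k \<le> p" for f k
    using assms that False csingular_simplex_face[of p S f k]
    by (auto simp: cchain_group_def intro!: order_trans[OF keys_cmul])
  have "(\<Sum>k\<le>p. frag_cmul ((-1) ^ k) (frag_of (singular_face p k f))) \<in> carrier ?G"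
    if "f \<in> Poly_Mapping.keys z" for f
    using *[OF that] unfolding cchain_group_def by (intro sum_closed_free_Abelian_group) auto
  then show ?thesis
    using False unfolding chain_boundary_def cchain_group_def
    by (auto simp: dest!: subsetD[OF keys_frag_extend])
qed (simp add: chain_boundary_def cchain_group_def)

lemma chain_boundary_cboundary:
  assumes "z \<in> carrier (cchain_group (Suc p) S)"
  shows "chain_boundary p (chain_boundary (Suc p) z) = 0"
proof (rule chain_boundary_boundary_alt)
  let ?T = "topology (\<lambda>U. U = {} \<or> U = (UNIV :: 'a set))"
  have op: "openin ?T U \<longleftrightarrow> U = {} \<or> U = UNIV" for U
    by (subst topology_inverse') (auto simp: istopology_def)
  then have tT: "topspace ?T = UNIV" by (auto simp: topspace_def)
  have "continuous_map Y ?T f" for Y :: "(nat \<Rightarrow> real) topology" and f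
    by (auto simp: continuous_map_def op tT)
  then show "singular_chain (Suc p) ?T z"
    using assms by (auto simp: singular_chain_def singular_simplex_def cchain_group_def
        csingular_simplex_def)
qed

lemma group_cchain_group: "group (cchain_group p S)"
  by (simp add: cchain_group_def)

lemma subgroup_ccycles: "subgroup (ccycles p S) (cchain_group p S)"
proof
  show "inv\<^bsub>cchain_group p S\<^esub> x \<in> ccycles p S" if "x \<in> ccycles p S" for x
    using that by (auto simp: ccycles_def cchain_group_def chain_boundary_minus)
qed (auto simp: ccycles_def cchain_group_def chain_boundary_add dest!: subsetD[OF keys_add])

lemma subgroup_cboundaries: "subgroup (cboundaries p S) (cchain_group p S)"
proof -
  have "chain_boundary (Suc p) \<in> hom (cchain_group (Suc p) S) (cchain_group p S)"
    using chain_boundary_cchain_group[of _ "Suc p" S]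
    by (auto intro!: homI simp: cchain_group_def chain_boundary_add)
  then have "group_hom (cchain_group (Suc p) S) (cchain_group p S) (chain_boundary (Suc p))"
    by (simp add: group_hom_def group_hom_axioms_def group_cchain_group)
  then show ?thesis
    unfolding cboundaries_def by (rule group_hom.img_is_subgroup)
qed

lemma comm_group_chomology_group: "comm_group (chomology_group p S)"
proof -
  let ?C = "cchain_group p S"
  have sub: "cboundaries p S \<subseteq> ccycles p S"
    unfolding cboundaries_def ccycles_def
    using chain_boundary_cchain_group[of _ "Suc p" S]
    by (auto simp del: carrier_free_Abelian_group_iff simp: chain_boundary_cboundary)
  have "comm_group (subgroup_generated ?C (ccycles p S))"
    by (intro group.abelian_subgroup_generated)
      (auto simp: cchain_group_def abelian_free_Abelian_group)
  moreover have "subgroup (cboundaries p S) (subgroup_generated ?C (ccycles p S))"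
    using sub subgroup_cboundaries group_cchain_group
    by (metis group.subgroup_of_subgroup_generated)
  ultimately show ?thesis
    unfolding chomology_group_def by (rule comm_group.abelian_FactGroup)
qed

end

theory Submission
  imports Defs
begin

text \<open>
  The wedge is a finite graph, and its closure operator sends a set to its closed neighbourhood. A
  map from a simplex into such a space is continuous iff every point has a neighbourhood all of whose
  values are adjacent to the value at that point. In particular every function into a clique is
  continuous. The first homology group is computed by giving generators of the cycles modulo
  boundaries and by detecting these generators with winding numbers.

  \<^bold>\<open>Generators.\<close> For adjacent vertices \<open>u\<close> and \<open>v\<close> let \<open>edge u v\<close> be the path that jumps from \<open>u\<close> to
  \<open>v\<close> at the last moment. A path that stays in the neighbourhood of one of its end points is homologous
  to an edge, so by bisection every cycle is, modulo boundaries, a combination of edges closed up by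
  arbitrary chosen chains \<open>P v\<close>, one for each vertex \<open>v\<close> (\<open>cycles_generated_by_edges\<close>). Let \<open>P v\<close> be the
  walk from the base point to \<open>v\<close> by unit steps inside its own cycle. The \<open>d + 1\<close> vertices spanned by an
  edge of length \<open>d \<le> m\<close> form a clique, hence that edge is homologous to \<open>d\<close> unit steps, and the
  closed-up edge to a multiple of the full turn (\<open>closed_up_edge\<close>). So the two full turns generate the
  homology (\<open>cycles_generated_by_turns\<close>). When \<open>n div 2 \<le> m\<close>, the cycle is a clique and its full turn bounds.

  \<^bold>\<open>Winding numbers.\<close> Suppose \<open>3 * m < n\<close>. A continuous map from a triangle or an interval to the
  circulant graph modulo \<open>n\<close> lifts to the integers, where values at nearby points differ by at most \<open>m\<close>:
  near a point one adds displacements of size at most \<open>m\<close>, and because of \<open>3 * m < n\<close>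
  two of them that are at distance at most \<open>m\<close> modulo \<open>n\<close> are so as integers
  (\<open>int_lift_star\<close>); local lifts are glued by bisection (\<open>int_lift_square\<close>). The
  displacement of the lift along a path extends to chains, vanishes on boundaries because a triangle lifts as a
  whole (\<open>winding_cboundary\<close>), and is divisible by \<open>n\<close> on cycles. Composing with the
  retraction of the wedge to one cycle yields an invariant with value \<open>n\<close> on the turn of that cycle
  and \<open>0\<close> on the other turn. Hence the turns of the cycles with \<open>1 \<le> m\<close> and
  \<open>3 * m < n\<close> are independent, and in each of the three cases the surviving turns form a basis of
  the homology.
\<close>

section \<open>Continuity into a graph\<close>

text \<open>The closure space of a graph on \<open>V\<close>. Intersecting with \<open>V\<close> makes the closure operator of the
  wedge literally equal to one of this form, also on sets that leave the carrier.\<close>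

definition graph_cspace :: "'v set \<Rightarrow> ('v \<Rightarrow> 'v \<Rightarrow> bool) \<Rightarrow> 'v cspace" where
  "graph_cspace V adj = (V, \<lambda>A. {v \<in> V. \<exists>u \<in> A \<inter> V. adj u v})"

text \<open>Continuity of \<open>f\<close> on \<open>K\<close> as a map into a finite graph, by \<open>csingular_simplex_graph_iff\<close>.\<close>

definition locally_adj :: "('v \<Rightarrow> 'v \<Rightarrow> bool) \<Rightarrow> 'a::topological_space set \<Rightarrow> ('a \<Rightarrow> 'v) \<Rightarrow> bool" where
  "locally_adj adj K f \<longleftrightarrow> (\<forall>x\<in>K. \<exists>U. open U \<and> x \<in> U \<and> (\<forall>y\<in>U \<inter> K. adj (f x) (f y)))"

lemma locally_adjE:
  assumes "locally_adj adj K f" "x \<in> K"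
  obtains U where "open U" "x \<in> U" "\<And>y. y \<in> U \<Longrightarrow> y \<in> K \<Longrightarrow> adj (f x) (f y)"
  using assms by (auto simp: locally_adj_def)

lemma locally_adj_subset:
  assumes "locally_adj adj K f" "L \<subseteq> K"
  shows "locally_adj adj L f"
  unfolding locally_adj_def
proof
  fix x assume "x \<in> L"
  with assms(2) have "x \<in> K" by blast
  then obtain U where "open U" "x \<in> U" "\<And>y. y \<in> U \<Longrightarrow> y \<in> K \<Longrightarrow> adj (f x) (f y)"
    by (rule locally_adjE[OF assms(1)]) blast
  then show "\<exists>U. open U \<and> x \<in> U \<and> (\<forall>y\<in>U \<inter> L. adj (f x) (f y))"
    using assms(2) by (intro exI[of _ U]) auto
qed

lemma locally_adj_relation:
  assumes "locally_adj adj K f"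
    and "\<And>x y. x \<in> K \<Longrightarrow> y \<in> K \<Longrightarrow> adj (f x) (f y) \<Longrightarrow> adj' (g x) (g y)"
  shows "locally_adj adj' K g"
  unfolding locally_adj_def
proof
  fix x assume x: "x \<in> K"
  then obtain U where "open U" "x \<in> U" "\<And>y. y \<in> U \<Longrightarrow> y \<in> K \<Longrightarrow> adj (f x) (f y)"
    by (rule locally_adjE[OF assms(1)]) blast
  then show "\<exists>U. open U \<and> x \<in> U \<and> (\<forall>y\<in>U \<inter> K. adj' (g x) (g y))"
    using x assms(2) by (intro exI[of _ U]) auto
qed

lemma locally_adj_clique:
  assumes "\<And>x y. x \<in> K \<Longrightarrow> y \<in> K \<Longrightarrow> adj (f x) (f y)"
  shows "locally_adj adj K f"
  unfolding locally_adj_def by (intro ballI exI[of _ UNIV]) (use assms in auto)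

lemma locally_adj_cong:
  assumes "\<And>x. x \<in> K \<Longrightarrow> f x = g x"
  shows "locally_adj adj K f \<longleftrightarrow> locally_adj adj K g"
  using locally_adj_relation[of adj K f adj g] locally_adj_relation[of adj K g adj f] assms by auto

lemma locally_adj_compose:
  assumes f: "locally_adj adj L f" and h: "continuous_on K h" "h \<in> K \<rightarrow> L"
  shows "locally_adj adj K (\<lambda>x. f (h x))"
  unfolding locally_adj_def
proof
  fix x assume x: "x \<in> K"
  then have "h x \<in> L" using h(2) by auto
  with f obtain U where U: "open U" "h x \<in> U" "\<And>y. y \<in> U \<Longrightarrow> y \<in> L \<Longrightarrow> adj (f (h x)) (f y)"
    by (rule locally_adjE) blast
  obtain A where "open A" "x \<in> A" "\<forall>y\<in>K. y \<in> A \<longrightarrow> h y \<in> U"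
    using h(1) x U(1,2) unfolding continuous_on_topological by meson
  then show "\<exists>A. open A \<and> x \<in> A \<and> (\<forall>y\<in>A \<inter> K. adj (f (h x)) (f (h y)))"
    using U(3) h(2) by blast
qed

lemma locally_adj_Un:
  assumes "closed K" "closed L" and K: "locally_adj adj K f" and L: "locally_adj adj L f"
  shows "locally_adj adj (K \<union> L) f"
proof -
  have part: "\<exists>U. open U \<and> x \<in> U \<and> (\<forall>y\<in>U \<inter> M. adj (f x) (f y))"
    if "closed M" "locally_adj adj M f" for x M
    using that by (cases "x \<in> M") (auto simp: locally_adj_def intro!: exI[of _ "- M"])
  show ?thesis
    unfolding locally_adj_def
  proof
    fix x
    from part[OF assms(1) K] obtain U where "open U \<and> x \<in> U \<and> (\<forall>y\<in>U \<inter> K. adj (f x) (f y))" ..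
    moreover from part[OF assms(2) L] obtain W
      where "open W \<and> x \<in> W \<and> (\<forall>y\<in>W \<inter> L. adj (f x) (f y))" ..
    ultimately show "\<exists>U. open U \<and> x \<in> U \<and> (\<forall>y\<in>U \<inter> (K \<union> L). adj (f x) (f y))"
      by (intro exI[of _ "U \<inter> W"]) blast
  qed
qed

lemma locally_adj_real:
  fixes K :: "real set"
  assumes "locally_adj adj K f" "x \<in> K"
  obtains d where "d > 0" "\<And>y. y \<in> K \<Longrightarrow> \<bar>y - x\<bar> < d \<Longrightarrow> adj (f x) (f y)"
proof -
  obtain U where U: "open U" "x \<in> U" "\<And>y. y \<in> U \<Longrightarrow> y \<in> K \<Longrightarrow> adj (f x) (f y)"
    using assms by (rule locally_adjE) blast
  then obtain d where "d > 0" "\<And>y. dist y x < d \<Longrightarrow> y \<in> U"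
    by (meson open_dist)
  with U(3) show thesis by (intro that[of d]) (auto simp: dist_real_def)
qed

text \<open>Finiteness of the graph is what turns the closure condition into a pointwise one: only
  finitely many vertices fail to be adjacent to \<open>f x\<close>, and \<open>x\<close> has a neighbourhood avoiding the
  fibres over all of them.\<close>

lemma csingular_simplex_graph_iff:
  assumes "finite V" and sym: "\<And>u v. adj u v \<Longrightarrow> adj v u" and refl: "\<And>v. v \<in> V \<Longrightarrow> adj v v"
  shows "csingular_simplex p (graph_cspace V adj) f \<longleftrightarrow>
    f \<in> standard_simplex p \<rightarrow> V \<and> locally_adj adj (standard_simplex p) f \<and>
    f \<in> extensional (standard_simplex p)"
proof -
  let ?D = "standard_simplex p"
  have cl: "subtopology (powertop_real UNIV) ?D closure_of A = ?D \<inter> closure A" if "A \<subseteq> ?D" for A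
    using that by (simp add: closure_of_subtopology euclidean_product_topology Int_absorb1)
  have *: "(\<forall>A. A \<subseteq> ?D \<longrightarrow> f ` (?D \<inter> closure A) \<subseteq> {v \<in> V. \<exists>u \<in> f ` A \<inter> V. adj u v})
      \<longleftrightarrow> locally_adj adj ?D f" (is "?L \<longleftrightarrow> ?R") if fV: "f \<in> ?D \<rightarrow> V"
  proof
    assume L: ?L
    show ?R
      unfolding locally_adj_def
    proof
      fix x assume x: "x \<in> ?D"
      define bad where "bad = {u \<in> V. \<not> adj u (f x)}"
      define U where "U = - (\<Union>u\<in>bad. closure {y \<in> ?D. f y = u})"
      have "finite bad" using assms(1) by (simp add: bad_def)
      then have "open U" unfolding U_def by (intro open_Compl closed_UN) auto
      moreover have "x \<in> U"
      proof (rule ccontr)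
        assume "x \<notin> U"
        then obtain u where u: "u \<in> bad" "x \<in> closure {y \<in> ?D. f y = u}" by (auto simp: U_def)
        have "f x \<in> {v \<in> V. \<exists>w \<in> f ` {y \<in> ?D. f y = u} \<inter> V. adj w v}"
          using L[rule_format, of "{y \<in> ?D. f y = u}"] u(2) x by blast
        with u(1) show False by (auto simp: bad_def)
      qed
      moreover have "adj (f x) (f y)" if y: "y \<in> U \<inter> ?D" for y
      proof -
        have "y \<in> closure {z \<in> ?D. f z = f y}" using y by (intro subsetD[OF closure_subset]) auto
        with y have "f y \<notin> bad" by (auto simp: U_def)
        then show ?thesis using y fV sym by (auto simp: bad_def)
      qed
      ultimately show "\<exists>U. open U \<and> x \<in> U \<and> (\<forall>y\<in>U \<inter> ?D. adj (f x) (f y))" by blast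
    qed
  next
    assume R: ?R
    show ?L
    proof (intro allI impI subsetI)
      fix A v assume A: "A \<subseteq> ?D" and "v \<in> f ` (?D \<inter> closure A)"
      then obtain x where x: "x \<in> ?D" "x \<in> closure A" "v = f x" by auto
      from R x(1) obtain U where U: "open U" "x \<in> U" "\<And>y. y \<in> U \<Longrightarrow> y \<in> ?D \<Longrightarrow> adj (f x) (f y)"
        by (rule locally_adjE) blast
      obtain a where "a \<in> A" "a \<in> U"
        using U(1,2) x(2) by (meson closure_iff_nhds_not_empty disjoint_iff order_refl)
      then show "v \<in> {v \<in> V. \<exists>u \<in> f ` A \<inter> V. adj u v}"
        using U(3)[of a] A fV sym x by blast
    qed
  qed
  have cont: "cspace_continuous (csimplex_space p) (graph_cspace V adj) f \<longleftrightarrow> f \<in> ?D \<rightarrow> V \<and>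
      (\<forall>A. A \<subseteq> ?D \<longrightarrow> f ` (?D \<inter> closure A) \<subseteq> {v \<in> V. \<exists>u \<in> f ` A \<inter> V. adj u v})"
    unfolding csimplex_space_def cspace_of_topology_def cspace_continuous_def
      graph_cspace_def prod.case topspace_standard_simplex
    by (simp only: cl cong: imp_cong)
  show ?thesis
    by (cases "f \<in> ?D \<rightarrow> V") (simp_all only: csingular_simplex_def cont * simp_thms)
qed


section \<open>Lifting to the integers\<close>

text \<open>A map into the circulant graph of residues modulo \<open>n\<close> is treated as a map to arbitrary integer
  representatives that is \<open>locally_adj\<close> for \<open>near_mod\<close>. A lift chooses representatives such that nearby
  values are close as integers.\<close>

definition near_mod :: "nat \<Rightarrow> nat \<Rightarrow> int \<Rightarrow> int \<Rightarrow> bool" where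
  "near_mod n m i j \<longleftrightarrow> (\<exists>k. \<bar>k\<bar> \<le> int m \<and> [j = i + k] (mod int n))"

definition int_lift :: "nat \<Rightarrow> nat \<Rightarrow> 'a::topological_space set \<Rightarrow> ('a \<Rightarrow> int) \<Rightarrow> ('a \<Rightarrow> int) \<Rightarrow> bool" where
  "int_lift n m K f g \<longleftrightarrow>
     (\<forall>x\<in>K. [g x = f x] (mod int n)) \<and> locally_adj (\<lambda>a b. \<bar>b - a\<bar> \<le> int m) K g"

lemma int_lift_cong: "int_lift n m K f g \<Longrightarrow> x \<in> K \<Longrightarrow> [g x = f x] (mod int n)"
  by (simp add: int_lift_def)

lemma int_lift_locally: "int_lift n m K f g \<Longrightarrow> locally_adj (\<lambda>a b. \<bar>b - a\<bar> \<le> int m) K g"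
  by (simp add: int_lift_def)

lemma int_lift_diff_cong:
  assumes "int_lift n m K f g" "int_lift n m L f h" "x \<in> K" "x \<in> L"
  shows "[g x - h x = 0] (mod int n)"
  using cong_diff[OF int_lift_cong[OF assms(1,3)] int_lift_cong[OF assms(2,4)]] by simp

lemma int_lift_subset:
  assumes "int_lift n m K f g" "L \<subseteq> K"
  shows "int_lift n m L f g"
  unfolding int_lift_def
proof
  show "\<forall>x\<in>L. [g x = f x] (mod int n)"
    using int_lift_cong[OF assms(1)] assms(2) by auto
  show "locally_adj (\<lambda>a b. \<bar>b - a\<bar> \<le> int m) L g"
    by (rule locally_adj_subset[OF int_lift_locally[OF assms(1)] assms(2)])
qed

lemma int_lift_compose:
  assumes "int_lift n m L f g" "continuous_on K h" "h \<in> K \<rightarrow> L"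
  shows "int_lift n m K (\<lambda>x. f (h x)) (\<lambda>x. g (h x))"
  unfolding int_lift_def
proof
  show "\<forall>x\<in>K. [g (h x) = f (h x)] (mod int n)"
    by (intro ballI int_lift_cong[OF assms(1)] funcset_mem[OF assms(3)])
  show "locally_adj (\<lambda>a b. \<bar>b - a\<bar> \<le> int m) K (\<lambda>x. g (h x))"
    by (rule locally_adj_compose[OF int_lift_locally[OF assms(1)] assms(2,3)])
qed

lemma cong_small_imp_eq:
  fixes a b :: int
  assumes "[a = b] (mod int n)" "\<bar>a - b\<bar> < int n"
  shows "a = b"
  using assms by (metis cong_iff_dvd_diff dvd_imp_le_int eq_iff_diff_eq_0 not_le abs_of_nat)

text \<open>Two lifts differ by a multiple of \<open>n\<close>, and near any point this difference moves by at most
  \<open>2 * m\<close>; so it is locally constant.\<close>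

lemma int_lift_unique:
  assumes "2 * m < n" "connected K" and g: "int_lift n m K f g" and h: "int_lift n m K f h"
    and "x \<in> K" "y \<in> K"
  shows "g x - h x = g y - h y"
proof (rule connected_local_const[OF assms(2) \<open>x \<in> K\<close> \<open>y \<in> K\<close>, of "\<lambda>x. g x - h x"], intro ballI)
  fix a assume a: "a \<in> K"
  obtain U where U: "open U" "a \<in> U" "\<And>b. b \<in> U \<Longrightarrow> b \<in> K \<Longrightarrow> \<bar>g b - g a\<bar> \<le> int m"
    by (rule locally_adjE[OF int_lift_locally[OF g] a]) blast
  obtain W where W: "open W" "a \<in> W" "\<And>b. b \<in> W \<Longrightarrow> b \<in> K \<Longrightarrow> \<bar>h b - h a\<bar> \<le> int m"
    by (rule locally_adjE[OF int_lift_locally[OF h] a]) blast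
  have "g a - h a = g b - h b" if b: "b \<in> U \<inter> W" "b \<in> K" for b
  proof (rule cong_small_imp_eq)
    show "[g a - h a = g b - h b] (mod int n)"
      using int_lift_diff_cong[OF g h a a] int_lift_diff_cong[OF g h b(2) b(2)]
      by (metis cong_sym cong_trans)
    show "\<bar>(g a - h a) - (g b - h b)\<bar> < int n"
      using U(3)[of b] W(3)[of b] b assms(1) by auto
  qed
  then show "\<forall>\<^sub>F b in at a within K. g a - h a = g b - h b"
    unfolding eventually_at_topological using U(1,2) W(1,2)
    by (intro exI[of _ "U \<inter> W"]) auto
qed

text \<open>Write \<open>f y\<close> as \<open>f x\<close> plus a displacement of size at most \<open>m\<close>. For \<open>y'\<close> close to \<open>y\<close> the two displacements differ by an integer
  of size at most \<open>2 * m\<close> that is congruent to one of size at most \<open>m\<close>. By \<open>3 * m < n\<close> the two are equal,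
  so the chosen representatives move by at most \<open>m\<close>.\<close>

lemma int_lift_star:
  assumes mn: "3 * m < n" and f: "locally_adj (near_mod n m) K f"
    and star: "\<And>y. y \<in> K \<Longrightarrow> near_mod n m (f x) (f y)"
  shows "\<exists>g. int_lift n m K f g"
proof -
  obtain k where k: "\<And>y. y \<in> K \<Longrightarrow> \<bar>k y\<bar> \<le> int m \<and> [f y = f x + k y] (mod int n)"
    using star unfolding near_mod_def by metis
  have step: "\<bar>(f x + k z) - (f x + k y)\<bar> \<le> int m"
    if yz: "y \<in> K" "z \<in> K" "near_mod n m (f y) (f z)" for y z
  proof -
    obtain l where l: "\<bar>l\<bar> \<le> int m" "[f z = f y + l] (mod int n)"
      using yz(3) unfolding near_mod_def by blast
    have "[f x + k z = f y + l] (mod int n)"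
      using l(2) k[OF yz(2)] by (metis cong_sym cong_trans)
    also have "[f y + l = f x + k y + l] (mod int n)"
      using k[OF yz(1)] cong_add_rcancel by blast
    finally have "[k z = k y + l] (mod int n)"
      by (metis add.assoc cong_add_lcancel)
    then have "k z = k y + l"
      by (rule cong_small_imp_eq) (use l(1) k[OF yz(1)] k[OF yz(2)] mn in linarith)
    with l(1) show ?thesis by simp
  qed
  have "int_lift n m K f (\<lambda>y. f x + k y)"
    unfolding int_lift_def
  proof
    show "\<forall>y\<in>K. [f x + k y = f y] (mod int n)"
      using k cong_sym by blast
    show "locally_adj (\<lambda>a b. \<bar>b - a\<bar> \<le> int m) K (\<lambda>y. f x + k y)"
      by (rule locally_adj_relation[OF f]) (rule step)
  qed
  then show ?thesis by blast
qed

text \<open>After shifting one lift by a multiple of \<open>n\<close> the two agree at \<open>z\<close>, hence by uniqueness on the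
  connected intersection.\<close>

lemma int_lift_glue:
  assumes "2 * m < n" "closed K" "closed L" "connected (K \<inter> L)" "z \<in> K \<inter> L"
    and "\<exists>g. int_lift n m K f g" "\<exists>g. int_lift n m L f g"
  shows "\<exists>g. int_lift n m (K \<union> L) f g"
proof -
  obtain g h where g: "int_lift n m K f g" and h: "int_lift n m L f h" using assms by blast
  define h' where "h' x = h x + (g z - h z)" for x
  have "[g z - h z = 0] (mod int n)"
    using int_lift_diff_cong[OF g h] assms(5) by auto
  then have "[h' x = h x] (mod int n)" for x
    unfolding h'_def by (metis add.right_neutral cong_add_lcancel)
  then have "[h' x = f x] (mod int n)" if "x \<in> L" for x
    using int_lift_cong[OF h that] cong_trans by blast
  moreover have "locally_adj (\<lambda>a b. \<bar>b - a\<bar> \<le> int m) L h'"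
    by (rule locally_adj_relation[OF int_lift_locally[OF h]]) (simp add: h'_def)
  ultimately have h': "int_lift n m L f h'"
    by (simp add: int_lift_def)
  have agree: "h' x = g x" if "x \<in> K \<inter> L" for x
    using int_lift_unique[OF assms(1,4) int_lift_subset[OF g] int_lift_subset[OF h], of x z] that assms(5)
    by (simp add: h'_def)
  define G where "G x = (if x \<in> K then g x else h' x)" for x
  have GK: "G x = g x" if "x \<in> K" for x using that by (simp add: G_def)
  have GL: "G x = h' x" if "x \<in> L" for x using that agree by (simp add: G_def)
  have "locally_adj (\<lambda>a b. \<bar>b - a\<bar> \<le> int m) (K \<union> L) G"
  proof (rule locally_adj_Un[OF assms(2,3)])
    show "locally_adj (\<lambda>a b. \<bar>b - a\<bar> \<le> int m) K G"
      using int_lift_locally[OF g] by (simp add: locally_adj_cong[OF GK])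
    show "locally_adj (\<lambda>a b. \<bar>b - a\<bar> \<le> int m) L G"
      using int_lift_locally[OF h'] by (simp add: locally_adj_cong[OF GL])
  qed
  then have "int_lift n m (K \<union> L) f G"
    using int_lift_cong[OF g] int_lift_cong[OF h'] by (auto simp: int_lift_def GK GL)
  then show ?thesis by blast
qed

text \<open>Lifts exist near every point by the star case. Bisection in the second coordinate yields
  a lift on a thin strip, bisection in the first one glues the strips. Each gluing is along a
  segment, which is connected.\<close>

lemma int_lift_square:
  fixes f :: "real \<times> real \<Rightarrow> int"
  assumes mn: "3 * m < n" and f: "locally_adj (near_mod n m) UNIV f"
  shows "\<exists>g. int_lift n m ({0..1} \<times> {0..1}) f g"
proof -
  have mn2: "2 * m < n" using mn by simp
  have strip: "\<exists>d>0. \<exists>g. int_lift n m ({x-d..x+d} \<times> {0..1}) f g" for x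
  proof (rule Bolzano[where P = "\<lambda>a b. \<exists>d>0. \<exists>g. int_lift n m ({x-d..x+d} \<times> {a..b}) f g"])
      fix a b c :: real
      assume trans: "\<exists>d>0. \<exists>g. int_lift n m ({x-d..x+d} \<times> {a..b}) f g"
        "\<exists>d>0. \<exists>g. int_lift n m ({x-d..x+d} \<times> {b..c}) f g" "a \<le> b" "b \<le> c"
      obtain d1 g1 where 1: "d1 > 0" "int_lift n m ({x-d1..x+d1} \<times> {a..b}) f g1" using trans by blast
      obtain d2 g2 where 2: "d2 > 0" "int_lift n m ({x-d2..x+d2} \<times> {b..c}) f g2" using trans by blast
      define d where "d = min d1 d2"
      have d: "d > 0" using 1 2 by (simp add: d_def)
      let ?K = "{x-d..x+d} \<times> {a..b}" and ?L = "{x-d..x+d} \<times> {b..c}"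
      have int: "?K \<inter> ?L = {x-d..x+d} \<times> {b}" using trans by auto
      have un: "?K \<union> ?L = {x-d..x+d} \<times> {a..c}" using trans by auto
      have "\<exists>g. int_lift n m (?K \<union> ?L) f g"
      proof (rule int_lift_glue[OF mn2, of _ _ "(x, b)"])
        show "connected (?K \<inter> ?L)" unfolding int by (intro connected_Times) auto
        show "(x, b) \<in> ?K \<inter> ?L" using d trans by auto
        show "\<exists>g. int_lift n m ?K f g" "\<exists>g. int_lift n m ?L f g"
          by (rule exI, rule int_lift_subset[OF 1(2)] int_lift_subset[OF 2(2)], force simp: d_def)+
      qed (auto intro: closed_Times)
      then show "\<exists>d>0. \<exists>g. int_lift n m ({x-d..x+d} \<times> {a..c}) f g" using d un by auto
    next
      fix y :: real
      obtain U where U: "open U" "(x, y) \<in> U" "\<And>z. z \<in> U \<Longrightarrow> near_mod n m (f (x, y)) (f z)"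
        using f by (rule locally_adjE[of _ _ _ "(x, y)"]) auto
      obtain A B where AB: "open A" "open B" "x \<in> A" "y \<in> B" "A \<times> B \<subseteq> U"
        by (rule open_prod_elim[OF U(1,2)]) auto
      obtain d where d: "d > 0" "cball x d \<subseteq> A"
        using AB(1,3) open_contains_cball[of A] by auto
      obtain e where e: "e > 0" "cball y e \<subseteq> B"
        using AB(2,4) open_contains_cball[of B] by auto
      have "\<exists>g. int_lift n m ({x-d..x+d} \<times> {a..b}) f g" if "a \<le> y" "y \<le> b" "b - a < e" for a b
      proof (rule int_lift_star[OF mn locally_adj_subset[OF f subset_UNIV], of _ "(x, y)"])
        fix z assume "z \<in> {x-d..x+d} \<times> {a..b}"
        then have "z \<in> cball x d \<times> cball y e" using that by (auto simp: dist_real_def)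
        then show "near_mod n m (f (x, y)) (f z)" using d e AB U(3) by blast
      qed
      then show "\<exists>e>0. \<forall>a b. a \<le> y \<and> y \<le> b \<and> b - a < e \<longrightarrow>
          (\<exists>d>0. \<exists>g. int_lift n m ({x-d..x+d} \<times> {a..b}) f g)"
        using d e by blast
  qed simp
  show ?thesis
  proof (rule Bolzano[where P = "\<lambda>a b. \<exists>g. int_lift n m ({a..b} \<times> {0..1}) f g"])
    fix a b c :: real
    assume trans: "\<exists>g. int_lift n m ({a..b} \<times> {0..1}) f g"
      "\<exists>g. int_lift n m ({b..c} \<times> {0..1}) f g" "a \<le> b" "b \<le> c"
    let ?K = "{a..b} \<times> {0..1::real}" and ?L = "{b..c} \<times> {0..1::real}"
    have int: "?K \<inter> ?L = {b} \<times> {0..1}" using trans by auto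
    have un: "?K \<union> ?L = {a..c} \<times> {0..1}" using trans by auto
    have "\<exists>g. int_lift n m (?K \<union> ?L) f g"
    proof (rule int_lift_glue[OF mn2, of _ _ "(b, 0)"])
      show "connected (?K \<inter> ?L)" unfolding int by (intro connected_Times) auto
    qed (use trans in \<open>auto intro: closed_Times\<close>)
    then show "\<exists>g. int_lift n m ({a..c} \<times> {0..1}) f g" using un by simp
  next
    fix x :: real
    obtain d g where d: "d > 0" "int_lift n m ({x-d..x+d} \<times> {0..1}) f g" using strip by blast
    have "int_lift n m ({a..b} \<times> {0..1}) f g" if "a \<le> x" "x \<le> b" "b - a < d" for a b
      using d(2) by (rule int_lift_subset) (use that in auto)
    then show "\<exists>d>0. \<forall>a b. a \<le> x \<and> x \<le> b \<and> b - a < d \<longrightarrow>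
        (\<exists>g. int_lift n m ({a..b} \<times> {0..1}) f g)"
      using d by blast
  qed simp
qed

text \<open>Intervals and triangles are retracts of the square: lift the composite with the retraction and
  restrict.\<close>

lemma int_lift_retract:
  fixes r :: "real \<times> real \<Rightarrow> 'a::topological_space"
  assumes "3 * m < n" and f: "locally_adj (near_mod n m) K f"
    and r: "continuous_on UNIV r" "range r \<subseteq> K"
    and i: "continuous_on K i" "i \<in> K \<rightarrow> {0..1} \<times> {0..1}" "\<And>x. x \<in> K \<Longrightarrow> r (i x) = x"
  shows "\<exists>g. int_lift n m K f g"
proof -
  have "locally_adj (near_mod n m) UNIV (\<lambda>z. f (r z))"
    by (rule locally_adj_compose[OF f r(1)]) (use r(2) in auto)
  then obtain g where "int_lift n m ({0..1} \<times> {0..1}) (\<lambda>z. f (r z)) g"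
    using int_lift_square[OF assms(1)] by blast
  from int_lift_compose[OF this i(1,2)] have "int_lift n m K (\<lambda>x. f (r (i x))) (\<lambda>x. g (i x))" .
  then have "int_lift n m K f (\<lambda>x. g (i x))"
    by (simp add: int_lift_def i(3))
  then show ?thesis by blast
qed

lemma int_lift_interval:
  fixes f :: "real \<Rightarrow> int"
  assumes "3 * m < n" "locally_adj (near_mod n m) {0..1} f"
  shows "\<exists>g. int_lift n m {0..1} f g"
  by (rule int_lift_retract[OF assms, where r = "\<lambda>(x, y). max 0 (min 1 x)" and i = "\<lambda>x. (x, 0)"])
    (auto simp: case_prod_beta intro!: continuous_intros)

definition triangle :: "(real \<times> real) set" where
  "triangle = {(x, y). 0 \<le> x \<and> 0 \<le> y \<and> x + y \<le> 1}"

lemma int_lift_triangle: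
  assumes "3 * m < n" "locally_adj (near_mod n m) triangle f"
  shows "\<exists>g. int_lift n m triangle f g"
proof -
  \<comment> \<open>The retraction clips to the positive quadrant and then scales towards the origin.\<close>
  define s where "s z = max 1 (max 0 (fst z) + max 0 (snd z))" for z :: "real \<times> real"
  have s: "s z \<ge> 1" "s z \<ge> max 0 (fst z) + max 0 (snd z)" for z by (auto simp: s_def)
  have cs: "continuous_on UNIV s" unfolding s_def by (intro continuous_intros)
  have s0: "s z \<noteq> 0" for z using s(1)[of z] by linarith
  show ?thesis
  proof (rule int_lift_retract[OF assms, where r = "\<lambda>z. (max 0 (fst z) / s z, max 0 (snd z) / s z)"
        and i = "\<lambda>z. z"])
    show "continuous_on UNIV (\<lambda>z. (max 0 (fst z) / s z, max 0 (snd z) / s z))"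
      using s0 by (intro continuous_intros cs) auto
    have "max 0 (fst z) / s z + max 0 (snd z) / s z \<le> 1" for z
      using s[of z] by (simp add: field_simps flip: add_divide_distrib)
    moreover have "0 \<le> max 0 a / s z" for a z
      using s(1)[of z] by (intro divide_nonneg_nonneg) auto
    ultimately show "range (\<lambda>z. (max 0 (fst z) / s z, max 0 (snd z) / s z)) \<subseteq> triangle"
      by (auto simp: triangle_def)
  qed (auto simp: triangle_def s_def max_def)
qed


section \<open>Low-dimensional singular simplices\<close>

(* The coordinate index 1 has to keep its shape to match the definitions below. *)
declare One_nat_def [simp del]


definition point_simplex :: "'v \<Rightarrow> (nat \<Rightarrow> real) \<Rightarrow> 'v" where
  "point_simplex v = restrict (\<lambda>_. v) (standard_simplex 0)"

definition path_simplex :: "(real \<Rightarrow> 'v) \<Rightarrow> (nat \<Rightarrow> real) \<Rightarrow> 'v" where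
  "path_simplex p = restrict (\<lambda>t. p (t 1)) (standard_simplex 1)"

definition triangle_simplex :: "(real \<times> real \<Rightarrow> 'v) \<Rightarrow> (nat \<Rightarrow> real) \<Rightarrow> 'v" where
  "triangle_simplex h = restrict (\<lambda>t. h (t 1, t 2)) (standard_simplex 2)"

text \<open>The inverse of dropping the coordinate with index \<open>0\<close>; with second coordinate \<open>0\<close> it parametrises
  the standard \<open>1\<close>-simplex.\<close>

definition barycentric :: "real \<times> real \<Rightarrow> nat \<Rightarrow> real" where
  "barycentric z i = (if i = 0 then 1 - fst z - snd z else if i = 1 then fst z
     else if i = 2 then snd z else 0)"

lemma continuous_on_barycentric: "continuous_on K barycentric"
proof (rule continuous_on_coordinatewise_then_product)
  fix i :: nat
  show "continuous_on K (\<lambda>z. barycentric z i)"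
    unfolding barycentric_def by (cases "i = 0"; cases "i = 1"; cases "i = 2") (auto intro!: continuous_intros)
qed

lemma atMost_1_2_nat: "{..1} = {0, 1 :: nat}" "{..2} = {0, 1, 2 :: nat}"
  by auto

lemma standard_simplex_1_iff:
  "t \<in> standard_simplex 1 \<longleftrightarrow> 0 \<le> t 1 \<and> t 1 \<le> 1 \<and> t = barycentric (t 1, 0)"
proof
  assume t: "t \<in> standard_simplex 1"
  then have "t 0 + t 1 = 1" "\<forall>i>1. t i = 0" by (auto simp: standard_simplex_def atMost_1_2_nat)
  then have "t = barycentric (t 1, 0)"
    by (intro ext) (auto simp: barycentric_def)
  then show "0 \<le> t 1 \<and> t 1 \<le> 1 \<and> t = barycentric (t 1, 0)"
    using t by (simp add: standard_simplex_def)
next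
  have "barycentric (x, 0) \<in> standard_simplex 1" if "0 \<le> x" "x \<le> 1" for x
    using that by (auto simp: standard_simplex_def barycentric_def atMost_1_2_nat)
  then show "0 \<le> t 1 \<and> t 1 \<le> 1 \<and> t = barycentric (t 1, 0) \<Longrightarrow> t \<in> standard_simplex 1"
    by metis
qed

lemma standard_simplex_2_iff:
  "t \<in> standard_simplex 2 \<longleftrightarrow> (t 1, t 2) \<in> triangle \<and> t = barycentric (t 1, t 2)"
proof
  assume t: "t \<in> standard_simplex 2"
  then have "t 0 + t 1 + t 2 = 1" "\<forall>i>2. t i = 0"
    by (auto simp: standard_simplex_def atMost_1_2_nat)
  then have "t = barycentric (t 1, t 2)" "t 1 + t 2 = 1 - t 0"
    by (auto simp: barycentric_def fun_eq_iff)
  moreover have "0 \<le> t 0" "0 \<le> t 1" "0 \<le> t 2" using t by (auto simp: standard_simplex_def)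
  ultimately show "(t 1, t 2) \<in> triangle \<and> t = barycentric (t 1, t 2)"
    by (simp add: triangle_def)
next
  have "barycentric z \<in> standard_simplex 2" if "z \<in> triangle" for z
    using that by (auto simp: standard_simplex_def barycentric_def triangle_def atMost_1_2_nat)
  then show "(t 1, t 2) \<in> triangle \<and> t = barycentric (t 1, t 2) \<Longrightarrow> t \<in> standard_simplex 2"
    by metis
qed

lemma path_simplex_barycentric:
  "0 \<le> s \<Longrightarrow> s \<le> 1 \<Longrightarrow> path_simplex p (barycentric (s, 0)) = p s"
  by (simp add: path_simplex_def standard_simplex_1_iff barycentric_def)

lemma point_simplex_barycentric: "point_simplex v (barycentric (0, 0)) = v"
proof -
  have "barycentric (0, 0) = (\<lambda>i. if i = 0 then 1 else 0)"
    by (auto simp: barycentric_def)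
  then show ?thesis by (simp add: point_simplex_def standard_simplex_0)
qed

lemma singular_face_path_simplex:
  "singular_face 1 0 (path_simplex p) = point_simplex (p 1)"
  "singular_face 1 1 (path_simplex p) = point_simplex (p 0)"
proof -
  have *: "simplical_face k t \<in> standard_simplex 1" if "t \<in> standard_simplex 0" "k \<le> 1" for k and t :: "nat \<Rightarrow> real"
    using simplical_face_in_standard_simplex[of 1 k t] that by simp
  show "singular_face 1 0 (path_simplex p) = point_simplex (p 1)"
    unfolding singular_face_def point_simplex_def path_simplex_def
    using *[of _ 0] by (intro ext) (auto simp: restrict_def simplical_face_def standard_simplex_0)
  show "singular_face 1 1 (path_simplex p) = point_simplex (p 0)"
    unfolding singular_face_def point_simplex_def path_simplex_def
    using *[of _ 1] by (intro ext) (auto simp: restrict_def simplical_face_def)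
qed

lemma singular_face_triangle_simplex:
  "singular_face 2 0 (triangle_simplex h) = path_simplex (\<lambda>s. h (1 - s, s))"
  "singular_face 2 1 (triangle_simplex h) = path_simplex (\<lambda>s. h (0, s))"
  "singular_face 2 2 (triangle_simplex h) = path_simplex (\<lambda>s. h (s, 0))"
proof -
  have *: "simplical_face k t \<in> standard_simplex 2" if "t \<in> standard_simplex 1" "k \<le> 2" for k and t :: "nat \<Rightarrow> real"
    using simplical_face_in_standard_simplex[of 2 k t] that by simp
  have 0: "t 0 = 1 - t 1" "t 2 = 0" if "t \<in> standard_simplex 1" for t
  proof -
    have "t = barycentric (t 1, 0)" using that by (simp add: standard_simplex_1_iff)
    from fun_cong[OF this, of 0] fun_cong[OF this, of 2] show "t 0 = 1 - t 1" "t 2 = 0"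
      by (simp_all add: barycentric_def)
  qed
  show "singular_face 2 0 (triangle_simplex h) = path_simplex (\<lambda>s. h (1 - s, s))"
    unfolding singular_face_def triangle_simplex_def path_simplex_def
    using *[of _ 0] 0 by (intro ext) (auto simp: restrict_def simplical_face_def One_nat_def)
  show "singular_face 2 1 (triangle_simplex h) = path_simplex (\<lambda>s. h (0, s))"
    unfolding singular_face_def triangle_simplex_def path_simplex_def
    using *[of _ 1] 0 by (intro ext) (auto simp: restrict_def simplical_face_def One_nat_def)
  show "singular_face 2 2 (triangle_simplex h) = path_simplex (\<lambda>s. h (s, 0))"
    unfolding singular_face_def triangle_simplex_def path_simplex_def
    using *[of _ 2] 0 by (intro ext) (auto simp: restrict_def simplical_face_def One_nat_def)
qed

lemma chain_boundary_path_simplex: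
  "chain_boundary 1 (frag_of (path_simplex p)) =
     frag_of (point_simplex (p 1)) - frag_of (point_simplex (p 0))"
  by (simp add: chain_boundary_of singular_face_path_simplex atMost_1_2_nat)

lemma chain_boundary_triangle_simplex:
  "chain_boundary 2 (frag_of (triangle_simplex h)) = frag_of (path_simplex (\<lambda>s. h (1 - s, s)))
     - frag_of (path_simplex (\<lambda>s. h (0, s))) + frag_of (path_simplex (\<lambda>s. h (s, 0)))"
  by (simp add: chain_boundary_of singular_face_triangle_simplex atMost_1_2_nat)


section \<open>Boundaries\<close>

lemma cboundaries_zero: "0 \<in> cboundaries p S"
  using subgroup.one_closed[OF subgroup_cboundaries[of p S]] by (simp add: cchain_group_def)

lemma cboundaries_diff:
  assumes "x \<in> cboundaries p S" "y \<in> cboundaries p S"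
  shows "x - y \<in> cboundaries p S"
proof -
  obtain a b where "a \<in> carrier (cchain_group (Suc p) S)" "x = chain_boundary (Suc p) a"
    "b \<in> carrier (cchain_group (Suc p) S)" "y = chain_boundary (Suc p) b"
    using assms unfolding cboundaries_def by blast
  then have "a - b \<in> carrier (cchain_group (Suc p) S)" "x - y = chain_boundary (Suc p) (a - b)"
    using keys_diff[of a b] by (auto simp: cchain_group_def chain_boundary_diff)
  then show ?thesis unfolding cboundaries_def by blast
qed

lemma cboundaries_uminus: "x \<in> cboundaries p S \<Longrightarrow> - x \<in> cboundaries p S"
  using cboundaries_diff[OF cboundaries_zero, of x p S] by simp

lemma cboundaries_add: "x \<in> cboundaries p S \<Longrightarrow> y \<in> cboundaries p S \<Longrightarrow> x + y \<in> cboundaries p S"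
  using cboundaries_diff[of x p S "- y"] cboundaries_uminus[of y p S] by simp

lemma cboundaries_subset_ccycles: "cboundaries p S \<subseteq> ccycles p S"
  unfolding cboundaries_def ccycles_def
  using chain_boundary_cchain_group[of _ "Suc p" S]
  by (auto simp del: carrier_free_Abelian_group_iff simp: chain_boundary_cboundary)


text \<open>The \<open>1\<close>-simplex along an edge: constantly \<open>u\<close> until it jumps to \<open>v\<close> at the last moment.\<close>

definition edge :: "'v \<Rightarrow> 'v \<Rightarrow> 'v chain" where
  "edge u v = frag_of (path_simplex (\<lambda>s. if s = 1 then v else u))"

lemma chain_boundary_edge:
  "chain_boundary 1 (edge u v) = frag_of (point_simplex v) - frag_of (point_simplex u)"
  by (simp add: edge_def chain_boundary_path_simplex)

locale reflexive_graph =
  fixes V :: "'v set" and adj :: "'v \<Rightarrow> 'v \<Rightarrow> bool"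
  assumes finite_V: "finite V"
    and adj_in_V: "adj u v \<Longrightarrow> u \<in> V"
    and adj_refl: "v \<in> V \<Longrightarrow> adj v v"
    and adj_sym: "adj u v \<Longrightarrow> adj v u"
begin

abbreviation "space \<equiv> graph_cspace V adj"

lemma csingular_simplex_iff:
  "csingular_simplex p space f \<longleftrightarrow>
     locally_adj adj (standard_simplex p) f \<and> f \<in> extensional (standard_simplex p)"
proof -
  have "f \<in> standard_simplex p \<rightarrow> V" if "locally_adj adj (standard_simplex p) f"
  proof
    fix x assume "x \<in> standard_simplex p"
    with that obtain U where "x \<in> U" "\<And>y. y \<in> U \<Longrightarrow> y \<in> standard_simplex p \<Longrightarrow> adj (f x) (f y)"
      by (rule locally_adjE) blast
    with \<open>x \<in> standard_simplex p\<close> show "f x \<in> V" using adj_in_V by blast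
  qed
  then show ?thesis
    using csingular_simplex_graph_iff[of V adj p f, OF finite_V adj_sym adj_refl] by blast
qed

lemma csingular_path_simplex:
  assumes "locally_adj adj {0..1} p"
  shows "csingular_simplex 1 space (path_simplex p)"
proof -
  have "locally_adj adj (standard_simplex 1) (\<lambda>t. p (t 1))"
    by (rule locally_adj_compose[OF assms continuous_on_product_then_coordinatewise[OF continuous_on_id]])
      (auto simp: standard_simplex_def)
  then have "locally_adj adj (standard_simplex 1) (path_simplex p)"
    unfolding path_simplex_def by (rule locally_adj_relation) simp
  then show ?thesis by (simp add: csingular_simplex_iff path_simplex_def)
qed

lemma csingular_simplex_1E:
  assumes "csingular_simplex 1 space f"
  obtains p where "f = path_simplex p" "locally_adj adj {0..1} p"
proof
  let ?p = "\<lambda>s. f (barycentric (s, 0))"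
  show "f = path_simplex ?p"
    using assms unfolding csingular_simplex_iff path_simplex_def extensional_def
    by (intro ext) (auto simp: restrict_def standard_simplex_1_iff)
  show "locally_adj adj {0..1} ?p"
  proof (rule locally_adj_compose[where f = f])
    show "locally_adj adj (standard_simplex 1) f"
      using assms by (simp add: csingular_simplex_iff)
    show "continuous_on {0..1} (\<lambda>s. barycentric (s, 0))"
      by (intro continuous_on_compose2[OF continuous_on_barycentric[of UNIV]] continuous_intros) auto
    show "(\<lambda>s. barycentric (s, 0)) \<in> {0..1} \<rightarrow> standard_simplex 1"
      by (auto simp: standard_simplex_1_iff barycentric_def)
  qed
qed

lemma csingular_triangle_simplex:
  assumes "locally_adj adj triangle h"
  shows "csingular_simplex 2 space (triangle_simplex h)"
proof -
  have "locally_adj adj (standard_simplex 2) (\<lambda>t. h (t 1, t 2))"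
  proof (rule locally_adj_compose[OF assms])
    show "continuous_on (standard_simplex 2) (\<lambda>t. (t 1, t 2))"
      by (intro continuous_on_Pair continuous_on_product_then_coordinatewise[OF continuous_on_id])
    show "(\<lambda>t. (t 1, t 2)) \<in> standard_simplex 2 \<rightarrow> triangle"
      by (simp add: standard_simplex_2_iff)
  qed
  then have "locally_adj adj (standard_simplex 2) (triangle_simplex h)"
    unfolding triangle_simplex_def by (rule locally_adj_relation) simp
  then show ?thesis by (simp add: csingular_simplex_iff triangle_simplex_def)
qed

lemma csingular_simplex_2E:
  assumes "csingular_simplex 2 space f"
  obtains h where "f = triangle_simplex h" "locally_adj adj triangle h"
proof
  let ?h = "\<lambda>z. f (barycentric z)"
  show "f = triangle_simplex ?h"
    using assms unfolding csingular_simplex_iff triangle_simplex_def extensional_def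
    by (intro ext) (auto simp: restrict_def standard_simplex_2_iff)
  show "locally_adj adj triangle ?h"
  proof (rule locally_adj_compose[where f = f])
    show "locally_adj adj (standard_simplex 2) f"
      using assms by (simp add: csingular_simplex_iff)
    show "barycentric \<in> triangle \<rightarrow> standard_simplex 2"
      by (auto simp: standard_simplex_2_iff barycentric_def)
  qed (rule continuous_on_barycentric)
qed

lemma triangle_boundary:
  assumes "locally_adj adj triangle h"
  shows "frag_of (path_simplex (\<lambda>s. h (1 - s, s))) - frag_of (path_simplex (\<lambda>s. h (0, s)))
    + frag_of (path_simplex (\<lambda>s. h (s, 0))) \<in> cboundaries 1 space"
  unfolding cboundaries_def chain_boundary_triangle_simplex[symmetric] Suc_1
  by (rule imageI) (simp add: cchain_group_def csingular_triangle_simplex[OF assms])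

text \<open>Every function into a clique is continuous.\<close>

lemma edge_triangle:
  assumes "adj u v" "adj v w" "adj u w"
  shows "edge u v + edge v w - edge u w \<in> cboundaries 1 space"
proof -
  define h where "h z = (if snd z = 1 then w else if fst z + snd z = 1 then v else u)"
    for z :: "real \<times> real"
  have "adj x y" if "x \<in> {u, v, w}" "y \<in> {u, v, w}" for x y
    using that assms adj_sym adj_refl adj_in_V by (metis empty_iff insert_iff)
  then have "locally_adj adj triangle h"
    by (intro locally_adj_clique) (auto simp: h_def)
  from triangle_boundary[OF this] show ?thesis
    by (simp add: h_def edge_def algebra_simps cong: if_cong)
qed

lemma edge_refl: "v \<in> V \<Longrightarrow> edge v v \<in> cboundaries 1 space"
  using edge_triangle[of v v v] by (simp add: adj_refl)

lemma edge_sym: "adj u v \<Longrightarrow> edge u v + edge v u \<in> cboundaries 1 space"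
  using cboundaries_add[OF edge_triangle[of u v u] edge_refl[of u]] adj_sym adj_in_V adj_refl
  by fastforce

text \<open>A path inside the neighbourhood of its starting point \<open>u\<close> is homologous to an edge: extend
  it from one side of the triangle by the value \<open>u\<close> elsewhere. Continuity holds because points
  with value \<open>u\<close> accept any value of the path nearby.\<close>

lemma path_in_star_of_start:
  assumes q: "locally_adj adj {0..1} q" and star: "\<And>s. 0 \<le> s \<Longrightarrow> s \<le> 1 \<Longrightarrow> adj (q 0) (q s)"
  shows "frag_of (path_simplex q) - edge (q 0) (q 1) \<in> cboundaries 1 space"
proof -
  define h where "h z = (if fst z + snd z = 1 then q (snd z) else q 0)" for z :: "real \<times> real"
  have q0: "q 0 \<in> V" using star[of 0] adj_in_V by auto
  have "locally_adj adj triangle h"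
    unfolding locally_adj_def
  proof
    fix z assume z: "z \<in> triangle"
    then have z01: "snd z \<in> {0..1}" by (auto simp: triangle_def)
    with q obtain U where U: "open U" "snd z \<in> U" "\<And>s. s \<in> U \<Longrightarrow> s \<in> {0..1} \<Longrightarrow> adj (q (snd z)) (q s)"
      by (rule locally_adjE) blast
    have "adj (h z) (h y)" if "y \<in> snd -` U" "y \<in> triangle" for y
      using U(3)[of "snd y"] star[of "snd y"] star[of "snd z"] z01 that adj_sym adj_refl[OF q0]
      by (auto simp: h_def triangle_def)
    moreover have "open (snd -` U :: (real \<times> real) set)"
      using U(1) by (rule open_vimage_snd)
    ultimately show "\<exists>U. open U \<and> z \<in> U \<and> (\<forall>y\<in>U \<inter> triangle. adj (h z) (h y))"
      using U(2) by (intro exI[of _ "snd -` U"]) auto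
  qed
  from triangle_boundary[OF this]
  have "frag_of (path_simplex q) - frag_of (path_simplex (\<lambda>s. if s = 1 then q 1 else q 0))
      + frag_of (path_simplex (\<lambda>s. q 0)) \<in> cboundaries 1 space"
    by (simp add: h_def cong: if_cong)
  from cboundaries_diff[OF this edge_refl[OF q0]] show ?thesis
    by (simp add: edge_def)
qed

text \<open>The mirror image needs a second application to the edge itself, because the triangle
  produces the path that jumps at the first moment instead of the last.\<close>

lemma path_in_star_of_end:
  assumes q: "locally_adj adj {0..1} q" and star: "\<And>s. 0 \<le> s \<Longrightarrow> s \<le> 1 \<Longrightarrow> adj (q s) (q 1)"
  shows "frag_of (path_simplex q) - edge (q 0) (q 1) \<in> cboundaries 1 space"
proof -
  define u v where "u = q 0" and "v = q 1"
  have v: "v \<in> V" and uv: "adj u v" using star[of 1] star[of 0] adj_in_V by (auto simp: u_def v_def)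
  let ?early = "frag_of (path_simplex (\<lambda>s. if s = 0 then u else v))"
  have *: "frag_of (path_simplex r) - ?early \<in> cboundaries 1 space"
    if r: "locally_adj adj {0..1} r" "r 0 = u" "r 1 = v" "\<And>s. 0 \<le> s \<Longrightarrow> s \<le> 1 \<Longrightarrow> adj (r s) v" for r
  proof -
    define h where "h z = (if fst z = 0 then r (snd z) else v)" for z :: "real \<times> real"
    have "locally_adj adj triangle h"
      unfolding locally_adj_def
    proof
      fix z assume z: "z \<in> triangle"
      then have z01: "snd z \<in> {0..1}" by (auto simp: triangle_def)
      with r(1) obtain U where U: "open U" "snd z \<in> U" "\<And>s. s \<in> U \<Longrightarrow> s \<in> {0..1} \<Longrightarrow> adj (r (snd z)) (r s)"
        by (rule locally_adjE) blast
      have "adj (h z) (h y)" if "y \<in> snd -` U" "y \<in> triangle" for y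
        using U(3)[of "snd y"] r(4)[of "snd y"] r(4)[of "snd z"] z01 that adj_sym adj_refl[OF v]
        by (auto simp: h_def triangle_def)
      moreover have "open (snd -` U :: (real \<times> real) set)"
        using U(1) by (rule open_vimage_snd)
      ultimately show "\<exists>U. open U \<and> z \<in> U \<and> (\<forall>y\<in>U \<inter> triangle. adj (h z) (h y))"
        using U(2) by (intro exI[of _ "snd -` U"]) auto
    qed
    from triangle_boundary[OF this]
    have "edge v v - frag_of (path_simplex r) + ?early \<in> cboundaries 1 space"
      by (simp add: h_def r(2,3) edge_def cong: if_cong)
    from cboundaries_diff[OF edge_refl[OF v] this] show ?thesis
      by (simp add: algebra_simps)
  qed
  have "edge u v - ?early \<in> cboundaries 1 space"
    unfolding edge_def
    by (rule *) (auto intro!: locally_adj_clique simp: uv adj_sym[OF uv] adj_refl[OF v]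
        adj_refl[OF adj_in_V[OF uv]])
  from cboundaries_diff[OF *[of q] this] show ?thesis
    using q star by (simp add: u_def v_def)
qed

text \<open>Fix for each vertex \<open>v\<close> a chain \<open>P v\<close>, thought of as a path from a base point to \<open>v\<close>, and
  close up every path \<open>p\<close> to \<open>P (p 0) + p - P (p 1)\<close>. In a cycle the added terms cancel, so it
  suffices to treat closed-up paths. These are additive under subdivision, and by bisection a
  path need only be examined near a point \<open>x\<close>, where it splits at \<open>x\<close> into two paths in the
  neighbourhood of \<open>p x\<close>, which are homologous to edges.\<close>

lemma cycles_generated_by_edges:
  fixes P :: "'v \<Rightarrow> 'v chain"
  assumes diff: "\<And>x y. x \<in> H \<Longrightarrow> y \<in> H \<Longrightarrow> x - y \<in> H"
    and bd: "cboundaries 1 space \<subseteq> H"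
    and edges: "\<And>u v. adj u v \<Longrightarrow> P u + edge u v - P v \<in> H"
    and z: "z \<in> ccycles 1 space"
  shows "z \<in> H"
proof -
  have zero: "0 \<in> H" using bd cboundaries_zero by blast
  have add: "x + y \<in> H" if "x \<in> H" "y \<in> H" for x y
    using diff[OF that(1) diff[OF zero that(2)]] by simp
  have path: "P (p 0) + frag_of (path_simplex p) - P (p 1) \<in> H" if p: "locally_adj adj {0..1} p" for p
  proof -
    define sub where "sub a b s = p (a + s * (b - a))" for a b s :: real
    define good where "good a b \<longleftrightarrow> (0 \<le> a \<longrightarrow> b \<le> 1 \<longrightarrow>
        P (p a) + frag_of (path_simplex (sub a b)) - P (p b) \<in> H)" for a b
    have sub_adj: "locally_adj adj {0..1} (sub a b)" if "0 \<le> a" "a \<le> b" "b \<le> 1" for a b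
      unfolding sub_def
    proof (rule locally_adj_compose[OF p])
      have "0 \<le> a + s * (b - a)" "a + s * (b - a) \<le> b" if "0 \<le> s" "s \<le> 1" for s
        using that \<open>0 \<le> a\<close> \<open>a \<le> b\<close> mult_right_mono[of s 1 "b - a"] by auto
      then show "(\<lambda>s. a + s * (b - a)) \<in> {0..1} \<rightarrow> {0..1}"
        using that by fastforce
    qed (intro continuous_intros)
    have trans: "good a c" if "good a b" "good b c" "a \<le> b" "b \<le> c" for a b c
      unfolding good_def
    proof (intro impI)
      assume ac: "0 \<le> a" "c \<le> 1"
      define h where "h z = p (a + fst z * (b - a) + snd z * (c - a))" for z :: "real \<times> real"
      have "locally_adj adj triangle h"
        unfolding h_def
      proof (rule locally_adj_compose[OF p])
        show "continuous_on triangle (\<lambda>z. a + fst z * (b - a) + snd z * (c - a))"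
          by (intro continuous_intros)
        have "0 \<le> a + x * (b - a) + y * (c - a) \<and> a + x * (b - a) + y * (c - a) \<le> 1"
          if xy: "0 \<le> x" "0 \<le> y" "x + y \<le> 1" for x y
        proof -
          have "x * (b - a) \<le> x * (c - a)" using \<open>b \<le> c\<close> xy by (intro mult_left_mono) auto
          moreover have "(x + y) * (c - a) \<le> 1 * (c - a)"
            using xy \<open>a \<le> b\<close> \<open>b \<le> c\<close> by (intro mult_right_mono) auto
          moreover have "0 \<le> x * (b - a)" "0 \<le> y * (c - a)" using xy \<open>a \<le> b\<close> \<open>b \<le> c\<close> by auto
          ultimately show ?thesis using ac by (simp add: algebra_simps)
        qed
        then show "(\<lambda>z. a + fst z * (b - a) + snd z * (c - a)) \<in> triangle \<rightarrow> {0..1}"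
          by (auto simp: triangle_def)
      qed
      from triangle_boundary[OF this]
      have "frag_of (path_simplex (\<lambda>s. h (1 - s, s))) - frag_of (path_simplex (\<lambda>s. h (0, s)))
          + frag_of (path_simplex (\<lambda>s. h (s, 0))) \<in> H"
        using bd by blast
      moreover have "(\<lambda>s. h (1 - s, s)) = sub b c" "(\<lambda>s. h (0, s)) = sub a c" "(\<lambda>s. h (s, 0)) = sub a b"
        by (simp_all add: h_def sub_def algebra_simps fun_eq_iff)
      ultimately have "frag_of (path_simplex (sub b c)) - frag_of (path_simplex (sub a c))
          + frag_of (path_simplex (sub a b)) \<in> H"
        by simp
      moreover have "(P (p a) + frag_of (path_simplex (sub a b)) - P (p b))
          + (P (p b) + frag_of (path_simplex (sub b c)) - P (p c)) \<in> H"
        using that ac by (intro add) (auto simp: good_def)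
      ultimately show "P (p a) + frag_of (path_simplex (sub a c)) - P (p c) \<in> H"
        using diff by (fastforce simp: algebra_simps)
    qed
    have "good 0 1"
    proof (rule Bolzano[where P = good, OF _ trans])
      fix x :: real assume "0 \<le> x" "x \<le> 1"
      then obtain d where d: "d > 0" "\<And>y. y \<in> {0..1} \<Longrightarrow> \<bar>y - x\<bar> < d \<Longrightarrow> adj (p x) (p y)"
        using locally_adj_real[OF p, of x] by auto
      have "good a b" if ab: "a \<le> x" "x \<le> b" "b - a < d" for a b
      proof (cases "0 \<le> a \<and> b \<le> 1")
        case True
        have adj_x: "adj (p x) (p y)" if "a \<le> y" "y \<le> b" for y
          using d(2)[of y] that ab True by auto
        have via_edge: "P (p s) + frag_of (path_simplex (sub s t)) - P (p t) \<in> H"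
          if "adj (p s) (p t)" "frag_of (path_simplex (sub s t)) - edge (p s) (p t) \<in> cboundaries 1 space" for s t
          using add[OF edges[OF that(1)], of "frag_of (path_simplex (sub s t)) - edge (p s) (p t)"]
            that(2) bd by (auto simp: algebra_simps)
        have range1: "a \<le> a + s * (x - a) \<and> a + s * (x - a) \<le> b"
          and range2: "a \<le> x + s * (b - x) \<and> x + s * (b - x) \<le> b" if s: "0 \<le> s" "s \<le> 1" for s
        proof -
          have "0 \<le> s * (x - a)" "s * (x - a) \<le> x - a" "0 \<le> s * (b - x)" "s * (b - x) \<le> b - x"
            using ab s by (simp_all add: mult_left_le_one_le)
          then show "a \<le> a + s * (x - a) \<and> a + s * (x - a) \<le> b"
            "a \<le> x + s * (b - x) \<and> x + s * (b - x) \<le> b"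
            using ab by linarith+
        qed
        have "good a x"
          unfolding good_def
        proof (intro impI via_edge)
          show "adj (p a) (p x)" using adj_x[of a] adj_sym ab by auto
          show "frag_of (path_simplex (sub a x)) - edge (p a) (p x) \<in> cboundaries 1 space"
            using path_in_star_of_end[OF sub_adj, of a x] ab True adj_sym[OF adj_x] range1
            by (simp add: sub_def)
        qed
        moreover have "good x b"
          unfolding good_def
        proof (intro impI via_edge)
          show "adj (p x) (p b)" using adj_x[of b] ab by auto
          show "frag_of (path_simplex (sub x b)) - edge (p x) (p b) \<in> cboundaries 1 space"
            using path_in_star_of_start[OF sub_adj, of x b] ab True adj_x range2
            by (simp add: sub_def)
        qed
        ultimately show ?thesis using trans ab by blast
      qed (auto simp: good_def)
      with d(1) show "\<exists>d>0. \<forall>a b. a \<le> x \<and> x \<le> b \<and> b - a < d \<longrightarrow> good a b"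
        by blast
    qed auto
    moreover have "sub 0 1 = p" by (simp add: sub_def fun_eq_iff)
    ultimately show ?thesis by (simp add: good_def)
  qed
  \<comment> \<open>For a path the correction that closes it up is \<open>- R\<close> of its boundary; \<open>barycentric (0, 0)\<close> is the
    only point of the standard \<open>0\<close>-simplex.\<close>
  define R :: "'v chain \<Rightarrow> 'v chain" where "R = frag_extend (\<lambda>f. P (f (barycentric (0, 0))))"
  have R_point: "R (frag_of (point_simplex v)) = P v" for v
    by (simp add: R_def point_simplex_barycentric)
  have R_diff: "R (a - b) = R a - R b" for a b
    by (simp add: R_def frag_extend_diff)
  have "z - R (chain_boundary 1 z) \<in> H"
  proof (rule frag_induction[where c = z and P = "\<lambda>z. z - R (chain_boundary 1 z) \<in> H"])
    show "Poly_Mapping.keys z \<subseteq> Collect (csingular_simplex 1 space)"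
      using z by (simp add: ccycles_def cchain_group_def)
    show "frag_of f - R (chain_boundary 1 (frag_of f)) \<in> H" if "f \<in> Collect (csingular_simplex 1 space)" for f
    proof -
      from that obtain p where "f = path_simplex p" "locally_adj adj {0..1} p"
        by (auto elim: csingular_simplex_1E)
      then show ?thesis
        using path[of p] by (simp add: chain_boundary_path_simplex R_diff R_point algebra_simps)
    qed
    show "(a - b) - R (chain_boundary 1 (a - b)) \<in> H"
      if "a - R (chain_boundary 1 a) \<in> H" "b - R (chain_boundary 1 b) \<in> H" for a b
      using diff[OF that] by (simp add: chain_boundary_diff R_diff algebra_simps)
  qed (simp add: R_def zero)
  moreover have "chain_boundary 1 z = 0" using z by (simp add: ccycles_def)
  ultimately show ?thesis by (simp add: R_def)
qed

end


section \<open>Winding numbers\<close>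

text \<open>The total displacement of a lift. For \<open>2 * m < n\<close> any two lifts differ by a constant, so the choice
  does not matter.\<close>

definition path_winding :: "nat \<Rightarrow> nat \<Rightarrow> (real \<Rightarrow> int) \<Rightarrow> int" where
  "path_winding n m q = (let g = SOME g. int_lift n m {0..1} q g in g 1 - g 0)"

lemma path_winding_eq:
  assumes "2 * m < n" "int_lift n m {0..1} q g"
  shows "path_winding n m q = g 1 - g 0"
proof -
  define g' where "g' = (SOME g. int_lift n m {0..1} q g)"
  have g': "int_lift n m {0..1} q g'"
    using assms(2) unfolding g'_def by (rule someI[of "int_lift n m {0..1} q"])
  have "g' 0 - g 0 = g' 1 - g 1"
    by (rule int_lift_unique[OF assms(1) _ g' assms(2)]) auto
  then show ?thesis by (simp add: path_winding_def Let_def flip: g'_def)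
qed

text \<open>The additive extension of an integer function on a basis; integers are viewed as formal
  multiples of the single generator \<open>()\<close> so that additivity comes from \<open>frag_extend\<close>.\<close>

definition frag_eval :: "('a \<Rightarrow> int) \<Rightarrow> ('a \<Rightarrow>\<^sub>0 int) \<Rightarrow> int" where
  "frag_eval w c = Poly_Mapping.lookup (frag_extend (\<lambda>f. frag_cmul (w f) (frag_of ())) c) ()"

lemma frag_eval_of [simp]: "frag_eval w (frag_of f) = w f"
  by (simp add: frag_eval_def)

lemma frag_eval_diff: "frag_eval w (a - b) = frag_eval w a - frag_eval w b"
  by (simp add: frag_eval_def frag_extend_diff lookup_minus)

lemma frag_eval_add: "frag_eval w (a + b) = frag_eval w a + frag_eval w b"
  by (simp add: frag_eval_def frag_extend_add lookup_add)

lemma frag_eval_0 [simp]: "frag_eval w 0 = 0"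
  by (simp add: frag_eval_def)

definition winding :: "nat \<Rightarrow> nat \<Rightarrow> ('v \<Rightarrow> int) \<Rightarrow> 'v chain \<Rightarrow> int" where
  "winding n m r = frag_eval (\<lambda>f. path_winding n m (\<lambda>s. r (f (barycentric (s, 0)))))"

lemma winding_add: "winding n m r (a + b) = winding n m r a + winding n m r b"
  by (simp add: winding_def frag_eval_add)

lemma winding_diff: "winding n m r (a - b) = winding n m r a - winding n m r b"
  by (simp add: winding_def frag_eval_diff)

lemma winding_0 [simp]: "winding n m r 0 = 0"
  by (simp add: winding_def)

lemma winding_path_simplex:
  assumes "2 * m < n" "int_lift n m {0..1} (\<lambda>s. r (p s)) g"
  shows "winding n m r (frag_of (path_simplex p)) = g 1 - g 0"
proof -
  have "int_lift n m {0..1} (\<lambda>s. r (path_simplex p (barycentric (s, 0)))) g"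
    using assms(2) by (simp add: int_lift_def path_simplex_barycentric)
  from path_winding_eq[OF assms(1) this] show ?thesis by (simp add: winding_def)
qed

lemma winding_edge:
  assumes "2 * m < n" "\<bar>k\<bar> \<le> int m" "[r v = r u + k] (mod int n)"
  shows "winding n m r (edge u v) = k"
proof -
  let ?g = "\<lambda>s::real. if s = 1 then r u + k else r u"
  have "int_lift n m {0..1} (\<lambda>s. r (if s = 1 then v else u)) ?g"
    unfolding int_lift_def using assms(2,3)
    by (auto intro!: locally_adj_clique simp: cong_sym)
  from winding_path_simplex[of m n r "\<lambda>s. if s = 1 then v else u", OF assms(1) this]
  show ?thesis by (simp add: edge_def)
qed

text \<open>The relation \<open>near_mod n m\<close> is adjacency in the circulant graph, so \<open>r\<close> is a continuous map from
  the graph to \<open>\<int>/n\<close>, and \<open>3 * m < n\<close> makes lifting through the integers possible.\<close>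

locale graph_over_cycle = reflexive_graph +
  fixes n m :: nat and r :: "'a \<Rightarrow> int"
  assumes small: "3 * m < n"
    and near: "adj u v \<Longrightarrow> near_mod n m (r u) (r v)"
begin

lemma small': "2 * m < n"
  using small by simp

lemma locally_near: "locally_adj adj K f \<Longrightarrow> locally_adj (near_mod n m) K (\<lambda>x. r (f x))"
  by (rule locally_adj_relation[of adj K f]) (simp_all add: near)

text \<open>A lift over the triangle restricts to lifts over its three sides, and the differences of its
  values at the three corners add up to zero.\<close>

lemma winding_cboundary:
  assumes "c \<in> cboundaries 1 space"
  shows "winding n m r c = 0"
proof -
  obtain e where c: "c = chain_boundary 2 e"
    and e: "Poly_Mapping.keys e \<subseteq> Collect (csingular_simplex 2 space)"
    using assms unfolding cboundaries_def cchain_group_def Suc_1 by auto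
  from e have "winding n m r (chain_boundary 2 e) = 0"
  proof (induction e rule: frag_induction)
    case (one f)
    then obtain h where f: "f = triangle_simplex h" and h: "locally_adj adj triangle h"
      by (auto elim: csingular_simplex_2E)
    obtain g where g: "int_lift n m triangle (\<lambda>z. r (h z)) g"
      using int_lift_triangle[OF small locally_near[OF h]] by blast
    have side: "winding n m r (frag_of (path_simplex (\<lambda>s. h (k s)))) = g (k 1) - g (k 0)"
      if "continuous_on {0..1} k" "k \<in> {0..1} \<rightarrow> triangle" for k
      by (rule winding_path_simplex[of m n r "\<lambda>s. h (k s)", OF small' int_lift_compose[OF g that]])
    have "winding n m r (frag_of (path_simplex (\<lambda>s. h (1 - s, s)))) = g (1 - 1, 1) - g (1 - 0, 0)"
      by (rule side) (auto simp: triangle_def intro!: continuous_intros)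
    moreover have "winding n m r (frag_of (path_simplex (\<lambda>s. h (0, s)))) = g (0, 1) - g (0, 0)"
      by (rule side) (auto simp: triangle_def intro!: continuous_intros)
    moreover have "winding n m r (frag_of (path_simplex (\<lambda>s. h (s, 0)))) = g (1, 0) - g (0, 0)"
      by (rule side) (auto simp: triangle_def intro!: continuous_intros)
    ultimately show ?case
      by (simp add: f chain_boundary_triangle_simplex winding_add winding_diff)
  qed (simp_all add: chain_boundary_diff winding_diff)
  with c show ?thesis by simp
qed

text \<open>Modulo \<open>n\<close> the winding number of a chain only depends on its boundary.\<close>

lemma winding_ccycle:
  assumes "z \<in> ccycles 1 space"
  shows "int n dvd winding n m r z"
proof -
  define R :: "'a chain \<Rightarrow> int" where "R = frag_eval (\<lambda>f. r (f (barycentric (0, 0))))"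
  have R_point: "R (frag_of (point_simplex v)) = r v" for v
    by (simp add: R_def point_simplex_barycentric)
  have R_diff: "R (a - b) = R a - R b" for a b
    by (simp add: R_def frag_eval_diff)
  have "Poly_Mapping.keys z \<subseteq> Collect (csingular_simplex 1 space)"
    using assms by (simp add: ccycles_def cchain_group_def)
  then have "[winding n m r z = R (chain_boundary 1 z)] (mod int n)"
  proof (induction z rule: frag_induction)
    case (one f)
    then obtain p where f: "f = path_simplex p" and p: "locally_adj adj {0..1} p"
      by (auto elim: csingular_simplex_1E)
    obtain g where g: "int_lift n m {0..1} (\<lambda>s. r (p s)) g"
      using int_lift_interval[OF small locally_near[OF p]] by blast
    show ?case
      using cong_diff[OF int_lift_cong[OF g, of 1] int_lift_cong[OF g, of 0]]
      by (simp add: f winding_path_simplex[of m n r p, OF small' g] chain_boundary_path_simplex R_diff R_point)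
  qed (auto simp: R_def chain_boundary_diff winding_diff frag_eval_diff intro: cong_diff)
  moreover have "chain_boundary 1 z = 0" using assms by (simp add: ccycles_def)
  ultimately show ?thesis by (simp add: R_def cong_0_iff)
qed

end


section \<open>Walks around a cycle\<close>

definition walk :: "(nat \<Rightarrow> 'v) \<Rightarrow> nat \<Rightarrow> 'v chain" where
  "walk v j = (\<Sum>l<j. edge (v l) (v (Suc l)))"

lemma walk_0 [simp]: "walk v 0 = 0"
  by (simp add: walk_def)

lemma walk_Suc: "walk v (Suc j) = walk v j + edge (v j) (v (Suc j))"
  by (simp add: walk_def)

lemma walk_add: "walk v (i + j) = walk v i + walk (\<lambda>l. v (i + l)) j"
  by (induction j) (simp_all add: walk_Suc add.assoc)

lemma walk_cycle_mod:
  assumes "\<And>l. v (n + l) = v l"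
  shows "walk v k = walk v (k mod n) + frag_cmul (int (k div n)) (walk v n)"
proof -
  have "walk v (n * q + s) = walk v s + frag_cmul (int q) (walk v n)" for q s
  proof (induction q)
    case (Suc q)
    have "walk v (n + (n * q + s)) = walk v n + walk v (n * q + s)"
      unfolding walk_add[of v n] assms ..
    with Suc show ?case by (simp add: frag_cmul_distrib algebra_simps)
  qed simp
  from this[of "k div n" "k mod n"] show ?thesis by simp
qed

lemma chain_boundary_walk:
  "chain_boundary 1 (walk v j) = frag_of (point_simplex (v j)) - frag_of (point_simplex (v 0))"
  by (induction j) (simp_all add: walk_Suc chain_boundary_add chain_boundary_edge)

lemma winding_cmul: "winding n m r (frag_cmul k c) = k * winding n m r c"
  by (simp add: winding_def frag_eval_def frag_extend_cmul)

lemma winding_walk: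
  assumes "2 * m < n" "\<bar>k\<bar> \<le> int m" "\<And>l. [r (v (Suc l)) = r (v l) + k] (mod int n)"
  shows "winding n m r (walk v j) = int j * k"
proof (induction j)
  case (Suc j)
  have "winding n m r (edge (v j) (v (Suc j))) = k"
    by (rule winding_edge[of m n k r "v (Suc j)" "v j", OF assms(1,2) assms(3)])
  with Suc show ?case by (simp add: walk_Suc winding_add algebra_simps)
qed simp

context reflexive_graph
begin

lemma edge_in_chains:
  assumes "adj u v"
  shows "edge u v \<in> carrier (cchain_group 1 space)"
proof -
  have "adj v u" "adj u u" "adj v v"
    using assms adj_sym adj_refl adj_in_V by blast+
  with assms show ?thesis
    unfolding edge_def cchain_group_def
    by (auto intro!: csingular_path_simplex locally_adj_clique)
qed

lemma closed_walk_in_ccycles: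
  assumes "\<And>l. l < j \<Longrightarrow> adj (v l) (v (Suc l))" "v j = v 0"
  shows "walk v j \<in> ccycles 1 space"
proof -
  have "walk v i \<in> carrier (cchain_group 1 space)" if "i \<le> j" for i
    using that
  proof (induction i)
    case (Suc i)
    then show ?case
      using edge_in_chains[OF assms(1)[of i]] keys_add[of "walk v i" "edge (v i) (v (Suc i))"]
      by (auto simp: walk_Suc cchain_group_def)
  qed (simp add: cchain_group_def)
  then show ?thesis by (simp add: ccycles_def chain_boundary_walk assms(2))
qed

text \<open>In a clique an edge is homologous to any walk between its end points: fan out from the
  first vertex.\<close>

lemma edge_walk_clique:
  assumes "\<And>i j. i \<le> d \<Longrightarrow> j \<le> d \<Longrightarrow> adj (v i) (v j)"
  shows "edge (v 0) (v d) - walk v d \<in> cboundaries 1 space"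
  using assms
proof (induction d)
  case 0
  then have "v 0 \<in> V" by (intro adj_in_V[of _ "v 0"]) simp
  then show ?case by (simp add: edge_refl)
next
  case (Suc d)
  have "edge (v 0) (v d) + edge (v d) (v (Suc d)) - edge (v 0) (v (Suc d)) \<in> cboundaries 1 space"
    by (rule edge_triangle) (use Suc.prems in auto)
  moreover have "edge (v 0) (v d) - walk v d \<in> cboundaries 1 space"
    by (rule Suc.IH) (use Suc.prems in auto)
  ultimately show ?case
    using cboundaries_diff by (fastforce simp: walk_Suc algebra_simps)
qed

lemma closed_walk_in_clique:
  assumes "\<And>i j. adj (v i) (v j)" "v n = v 0"
  shows "walk v n \<in> cboundaries 1 space"
  using cboundaries_diff[OF edge_refl[of "v 0"] edge_walk_clique[of n v]] assms adj_in_V by auto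

text \<open>Let the vertices \<open>v l\<close> run around a circulant graph. An edge of length \<open>d \<le> m\<close> lies in a
  clique together with the steps that it skips, so it is homologous to a difference of two walks from
  \<open>v 0\<close>. Reducing these walks to the standard ones of length below \<open>n\<close> costs multiples of the full turn.\<close>

lemma closed_up_edge:
  assumes diff: "\<And>x y. x \<in> H \<Longrightarrow> y \<in> H \<Longrightarrow> x - y \<in> H"
    and bd: "cboundaries 1 space \<subseteq> H" and turn: "walk v n \<in> H"
    and periodic: "\<And>l. v (n + l) = v l"
    and adj: "\<And>i d. d \<le> m \<Longrightarrow> adj (v i) (v (i + d))"
    and P: "\<And>l. P (v l) = walk v (l mod n)"
    and d: "d \<le> m"
  shows "P (v i) + edge (v i) (v (i + d)) - P (v (i + d)) \<in> H"
    and "P (v (i + d)) + edge (v (i + d)) (v i) - P (v i) \<in> H"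
proof -
  have zero: "0 \<in> H" using bd cboundaries_zero by blast
  have add: "x + y \<in> H" if "x \<in> H" "y \<in> H" for x y
    using diff[OF that(1) diff[OF zero that(2)]] by simp
  have mult: "frag_cmul (int q) (walk v n) \<in> H" for q
    by (induction q) (use zero add turn in \<open>simp_all add: frag_cmul_distrib\<close>)
  have "adj (v (i + a)) (v (i + b))" if "a \<le> d" "b \<le> d" for a b
    using adj[of "b - a" "i + a"] adj_sym[OF adj[of "a - b" "i + b"]] that d
    by (cases "a \<le> b") auto
  from edge_walk_clique[of d "\<lambda>l. v (i + l)", OF this]
  have "edge (v i) (v (i + d)) - (walk v (i + d) - walk v i) \<in> H"
    using bd by (auto simp: walk_add)
  moreover have "walk v k = P (v k) + frag_cmul (int (k div n)) (walk v n)" for k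
    unfolding P by (rule walk_cycle_mod) (rule periodic)
  ultimately have "edge (v i) (v (i + d)) - (P (v (i + d)) + frag_cmul (int ((i + d) div n)) (walk v n)
      - (P (v i) + frag_cmul (int (i div n)) (walk v n))) \<in> H"
    by metis
  from diff[OF add[OF this mult[of "(i + d) div n"]] mult[of "i div n"]]
  show 1: "P (v i) + edge (v i) (v (i + d)) - P (v (i + d)) \<in> H"
    by (simp add: algebra_simps)
  have "edge (v i) (v (i + d)) + edge (v (i + d)) (v i) \<in> H"
    using edge_sym[OF adj[OF d]] bd by blast
  from diff[OF this 1] show "P (v (i + d)) + edge (v (i + d)) (v i) - P (v i) \<in> H"
    by (simp add: algebra_simps)
qed

end

section \<open>Computing the homology group\<close>

lemma chomology_group_iso:
  assumes K: "group K" and F: "\<And>z. z \<in> ccycles p S \<Longrightarrow> F z \<in> carrier K"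
    and add: "\<And>x y. x \<in> ccycles p S \<Longrightarrow> y \<in> ccycles p S \<Longrightarrow> F (x + y) = F x \<otimes>\<^bsub>K\<^esub> F y"
    and surj: "\<And>k. k \<in> carrier K \<Longrightarrow> \<exists>z \<in> ccycles p S. F z = k"
    and ker: "\<And>z. z \<in> ccycles p S \<Longrightarrow> F z = \<one>\<^bsub>K\<^esub> \<longleftrightarrow> z \<in> cboundaries p S"
  shows "chomology_group p S \<cong> K"
proof -
  let ?Z = "subgroup_generated (cchain_group p S) (ccycles p S)"
  have carr: "carrier ?Z = ccycles p S"
    by (rule subgroup.carrier_subgroup_generated_subgroup[OF subgroup_ccycles])
  have mult: "x \<otimes>\<^bsub>cchain_group p S\<^esub> y = x + y" for x y
    by (simp add: cchain_group_def)
  have "F \<in> hom ?Z K"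
    by (rule homI) (use F add mult in \<open>simp_all add: carr\<close>)
  then interpret F: group_hom ?Z K F
    using K group.group_subgroup_generated[OF group_cchain_group]
    by (simp add: group_hom_def group_hom_axioms_def)
  have "kernel ?Z K F = cboundaries p S"
    using ker cboundaries_subset_ccycles[of p S] by (auto simp: kernel_def carr)
  moreover have "F ` carrier ?Z = carrier K"
    using F surj by (force simp: carr)
  ultimately show ?thesis
    using F.FactGroup_iso by (simp add: chomology_group_def)
qed

lemma cboundaries_cmul:
  assumes "x \<in> cboundaries p S" shows "frag_cmul k x \<in> cboundaries p S"
proof -
  obtain a where "a \<in> carrier (cchain_group (Suc p) S)" "x = chain_boundary (Suc p) a"
    using assms unfolding cboundaries_def by blast
  then have "frag_cmul k a \<in> carrier (cchain_group (Suc p) S)"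
    "frag_cmul k x = chain_boundary (Suc p) (frag_cmul k a)"
    using keys_cmul[of k a] by (auto simp: cchain_group_def chain_boundary_cmul)
  then show ?thesis unfolding cboundaries_def by blast
qed

lemma ccycles_cmul:
  assumes "z \<in> ccycles p S" shows "frag_cmul k z \<in> ccycles p S"
  using assms keys_cmul[of k z] by (auto simp: ccycles_def cchain_group_def chain_boundary_cmul)

lemma ccycles_add:
  assumes "z \<in> ccycles p S" "w \<in> ccycles p S" shows "z + w \<in> ccycles p S"
  using assms keys_add[of z w] by (auto simp: ccycles_def cchain_group_def chain_boundary_add)

text \<open>The winding number divided by \<open>n\<close> counts how often the generator \<open>G\<close> occurs in a cycle, and it
  vanishes on boundaries.\<close>

lemma (in graph_over_cycle) chomology_group_infinite_cyclic:
  assumes G: "G \<in> ccycles 1 space" "winding n m r G = int n"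
    and gen: "\<And>z. z \<in> ccycles 1 space \<Longrightarrow> \<exists>a. z - frag_cmul a G \<in> cboundaries 1 space"
  shows "chomology_group 1 space \<cong> integer_group"
proof (rule chomology_group_iso[where F = "\<lambda>z. winding n m r z div int n"])
  have n: "n > 0" using small by simp
  show "winding n m r z div int n = \<one>\<^bsub>integer_group\<^esub> \<longleftrightarrow> z \<in> cboundaries 1 space"
    if z: "z \<in> ccycles 1 space" for z
  proof -
    obtain a where a: "z - frag_cmul a G \<in> cboundaries 1 space" using gen[OF z] ..
    then have "winding n m r z = a * int n"
      using winding_cboundary[OF a] by (simp add: winding_diff winding_cmul G)
    then show ?thesis using a n winding_cboundary[of z] by auto
  qed
  show "\<exists>z \<in> ccycles 1 space. winding n m r z div int n = k" for k
    by (rule bexI[OF _ ccycles_cmul[OF G(1), of k]]) (use n in \<open>simp add: winding_cmul G\<close>)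
qed (simp_all add: winding_add div_plus_div_distrib_dvd_left winding_ccycle)

lemma chomology_group_free_rank_2:
  assumes "graph_over_cycle V adj n1 m1 r1" "graph_over_cycle V adj n2 m2 r2"
    and G: "G1 \<in> ccycles 1 (graph_cspace V adj)" "G2 \<in> ccycles 1 (graph_cspace V adj)"
    and w: "winding n1 m1 r1 G1 = int n1" "winding n1 m1 r1 G2 = 0"
      "winding n2 m2 r2 G1 = 0" "winding n2 m2 r2 G2 = int n2"
    and gen: "\<And>z. z \<in> ccycles 1 (graph_cspace V adj) \<Longrightarrow>
      \<exists>a b. z - (frag_cmul a G1 + frag_cmul b G2) \<in> cboundaries 1 (graph_cspace V adj)"
  shows "chomology_group 1 (graph_cspace V adj) \<cong> integer_group \<times>\<times> integer_group"
proof -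
  interpret A: graph_over_cycle V adj n1 m1 r1 by fact
  interpret B: graph_over_cycle V adj n2 m2 r2 by fact
  have n: "n1 > 0" "n2 > 0" using A.small B.small by simp_all
  show ?thesis
  proof (rule chomology_group_iso[where
        F = "\<lambda>z. (winding n1 m1 r1 z div int n1, winding n2 m2 r2 z div int n2)"])
    show "(winding n1 m1 r1 z div int n1, winding n2 m2 r2 z div int n2) = \<one>\<^bsub>integer_group \<times>\<times> integer_group\<^esub>
        \<longleftrightarrow> z \<in> cboundaries 1 A.space" if z: "z \<in> ccycles 1 A.space" for z
    proof -
      obtain a b where ab: "z - (frag_cmul a G1 + frag_cmul b G2) \<in> cboundaries 1 A.space"
        using gen[OF z] by blast
      then have "winding n1 m1 r1 z = a * int n1" "winding n2 m2 r2 z = b * int n2"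
        using A.winding_cboundary[OF ab] B.winding_cboundary[OF ab]
        by (simp_all add: winding_diff winding_add winding_cmul w)
      then show ?thesis
        using ab n A.winding_cboundary[of z] B.winding_cboundary[of z] by (auto simp: one_DirProd)
    qed
    show "\<exists>z \<in> ccycles 1 A.space. (winding n1 m1 r1 z div int n1, winding n2 m2 r2 z div int n2) = k" for k
      by (rule bexI[OF _ ccycles_add[OF ccycles_cmul[OF G(1), of "fst k"] ccycles_cmul[OF G(2), of "snd k"]]])
        (use n in \<open>simp add: winding_add winding_cmul w\<close>)
  qed (simp_all add: winding_add div_plus_div_distrib_dvd_left A.winding_ccycle B.winding_ccycle DirProd_group)
qed

lemma chomology_group_trivial:
  assumes "\<And>z. z \<in> ccycles p S \<Longrightarrow> z \<in> cboundaries p S"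
  shows "trivial_group (chomology_group p S)"
proof -
  have "chomology_group p S \<cong> singleton_group ()"
  proof (rule chomology_group_iso[where F = "\<lambda>_. ()"])
    show "\<exists>z \<in> ccycles p S. () = k" for k
      using subsetD[OF cboundaries_subset_ccycles cboundaries_zero, of p S] by (intro bexI[of _ 0]) auto
  qed (use assms in \<open>auto simp: singleton_group_def[symmetric]\<close>)
  moreover have "group (singleton_group ())" by (rule singleton_group)
  ultimately have "trivial_group (chomology_group p S) \<longleftrightarrow> trivial_group (singleton_group ())"
    by (rule isomorphic_group_triviality[OF _ comm_group.axioms(2)[OF comm_group_chomology_group]])
  then show ?thesis by simp
qed


section \<open>The wedge of two cycles\<close>

lemma Zn_dist_le_iff: "Zn_dist n i j \<le> m \<longleftrightarrow> near_mod n m i j"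
proof
  assume "Zn_dist n i j \<le> m"
  moreover obtain k where k: "[k = i - j] (mod int n)" "Zn_dist n i j = nat \<bar>k\<bar>"
    using Zn_dist_attained by blast
  ultimately have "\<bar>- k\<bar> \<le> int m" by simp
  moreover have "[j = i + - k] (mod int n)"
    using cong_diff[OF cong_refl[of i] k(1)] by (simp add: cong_sym)
  ultimately show "near_mod n m i j" unfolding near_mod_def by blast
next
  assume "near_mod n m i j"
  then obtain k where k: "\<bar>k\<bar> \<le> int m" "[j = i + k] (mod int n)"
    unfolding near_mod_def by blast
  have "[- k = i - j] (mod int n)"
    using cong_diff[OF cong_refl[of i] k(2)] by (simp add: cong_sym)
  then have "Zn_dist n i j \<le> nat \<bar>- k\<bar>"
    unfolding Zn_dist_def by (intro Least_le) blast
  with k(1) show "Zn_dist n i j \<le> m" by simp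
qed

lemma near_mod_refl: "near_mod n m i i"
  unfolding near_mod_def by (intro exI[of _ 0]) auto

lemma near_mod_sym: "near_mod n m i j \<Longrightarrow> near_mod n m j i"
proof -
  assume "near_mod n m i j"
  then obtain k where k: "\<bar>k\<bar> \<le> int m" "[j = i + k] (mod int n)"
    unfolding near_mod_def by blast
  have "[i = j + - k] (mod int n)"
    using cong_diff[OF k(2) cong_refl[of k]] by (simp add: cong_sym)
  with k(1) show ?thesis unfolding near_mod_def by (intro exI[of _ "- k"]) simp
qed

text \<open>For \<open>n div 2 \<le> m\<close> the circulant graph is complete, as one of the two arcs between any two
  residues has length at most \<open>n div 2\<close>.\<close>

lemma near_mod_total:
  assumes "n \<ge> 1" "n div 2 \<le> m"
  shows "near_mod n m i j"
proof -
  define k where "k = (j - i) mod int n"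
  have k: "0 \<le> k" "k < int n" using assms(1) by (simp_all add: k_def)
  have c: "[k = j - i] (mod int n)" by (simp add: k_def)
  show ?thesis
  proof (cases "k \<le> int m")
    case True
    have "[j = i + k] (mod int n)"
      using cong_add[OF cong_refl[of i] c] by (simp add: cong_sym)
    with True k show ?thesis unfolding near_mod_def by (intro exI[of _ k]) simp
  next
    case False
    have "[k - int n = k] (mod int n)"
      by (simp add: cong_iff_dvd_diff)
    then have "[k - int n = j - i] (mod int n)"
      using c by (rule cong_trans)
    from cong_add[OF cong_refl[of i] this] have "[j = i + (k - int n)] (mod int n)"
      by (simp add: cong_sym)
    moreover have "int n - k \<le> int m"
      using False assms(2) by linarith
    ultimately show ?thesis using k unfolding near_mod_def by (intro exI[of _ "k - int n"]) auto
  qed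
qed

text \<open>The vertex reached from \<open>x\<close> after \<open>l\<close> unit steps.\<close>

definition cycle_vertex :: "nat \<Rightarrow> int \<Rightarrow> nat \<Rightarrow> int" where
  "cycle_vertex n x l = (x + int l) mod int n"

lemma cycle_vertex_in_Zn: "x \<in> Zn n \<Longrightarrow> cycle_vertex n x l \<in> Zn n"
  by (simp add: cycle_vertex_def Zn_def)

lemma cycle_vertex_periodic: "cycle_vertex n x (n + l) = cycle_vertex n x l"
proof -
  have "x + int (n + l) = (x + int l) + int n" by simp
  then show ?thesis unfolding cycle_vertex_def by (metis mod_add_self2)
qed

lemma cycle_vertex_cong: "[cycle_vertex n x (l + d) = cycle_vertex n x l + int d] (mod int n)"
  by (simp add: cycle_vertex_def cong_def mod_add_left_eq add.assoc)

lemma cycle_vertex_index: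
  assumes "x \<in> Zn n"
  shows "nat ((cycle_vertex n x l - x) mod int n) = l mod n"
proof -
  have "(cycle_vertex n x l - x) mod int n = int l mod int n"
    by (simp add: cycle_vertex_def mod_diff_left_eq)
  then show ?thesis by (simp flip: zmod_int)
qed

lemma near_mod_cycle_vertexE:
  assumes x: "x \<in> Zn n" and ij: "i \<in> Zn n" "j \<in> Zn n" "near_mod n m i j"
  obtains l d where "d \<le> m" "i = cycle_vertex n x l \<and> j = cycle_vertex n x (l + d) \<or>
    j = cycle_vertex n x l \<and> i = cycle_vertex n x (l + d)"
proof -
  have onto: "\<exists>l. i = cycle_vertex n x l" if "i \<in> Zn n" for i
  proof
    show "i = cycle_vertex n x (nat ((i - x) mod int n))"
      using that by (auto simp: cycle_vertex_def Zn_def mod_add_right_eq)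
  qed
  have forward: "\<exists>l d. d \<le> m \<and> i = cycle_vertex n x l \<and> j = cycle_vertex n x (l + d)"
    if k: "i \<in> Zn n" "j \<in> Zn n" "0 \<le> k" "k \<le> int m" "[j = i + k] (mod int n)" for i j k
  proof -
    obtain l where l: "i = cycle_vertex n x l" using onto[OF k(1)] by blast
    have "j = (i + k) mod int n"
      using k(2,5) by (simp add: cong_def Zn_def)
    then have "j = cycle_vertex n x (l + nat k)"
      using k(3) l by (simp add: cycle_vertex_def mod_add_left_eq add.assoc)
    with l k(3,4) show ?thesis by (intro exI[of _ l] exI[of _ "nat k"]) simp
  qed
  obtain k where k: "\<bar>k\<bar> \<le> int m" "[j = i + k] (mod int n)"
    using ij(3) unfolding near_mod_def by blast
  show thesis
  proof (cases "0 \<le> k")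
    case True
    then show ?thesis using forward[OF ij(1,2), of k] k that by auto
  next
    case False
    have "[i = j + - k] (mod int n)"
      using cong_diff[OF k(2) cong_refl[of k]] by (simp add: cong_sym)
    then show ?thesis using forward[OF ij(2,1), of "- k"] k(1) False that by auto
  qed
qed

locale cycle_wedge =
  fixes n1 n2 m1 m2 :: nat and x1 x2 :: int
  assumes x1: "x1 \<in> Zn n1" and x2: "x2 \<in> Zn n2"
begin

lemma n1_pos: "1 \<le> n1" and n2_pos: "1 \<le> n2"
  using x1 x2 by (auto simp: Zn_def)

definition inc1 :: "int \<Rightarrow> (int + int) set" where
  "inc1 i = wedge_rel (Zn n1) x1 (Zn n2) x2 `` {Inl i}"

definition inc2 :: "int \<Rightarrow> (int + int) set" where
  "inc2 j = wedge_rel (Zn n1) x1 (Zn n2) x2 `` {Inr j}"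

text \<open>The two retractions collapse the other cycle to the base point.\<close>

definition ret1 :: "(int + int) set \<Rightarrow> int" where
  "ret1 u = (if \<exists>i. Inl i \<in> u then THE i. Inl i \<in> u else x1)"

definition ret2 :: "(int + int) set \<Rightarrow> int" where
  "ret2 u = (if \<exists>j. Inr j \<in> u then THE j. Inr j \<in> u else x2)"

lemma inc1_eq: "i \<in> Zn n1 \<Longrightarrow> inc1 i = (if i = x1 then {Inl x1, Inr x2} else {Inl i})"
  by (auto simp: inc1_def wedge_rel_def)

lemma inc2_eq: "j \<in> Zn n2 \<Longrightarrow> inc2 j = (if j = x2 then {Inl x1, Inr x2} else {Inr j})"
  by (auto simp: inc2_def wedge_rel_def)

lemma ret1_inc1 [simp]: "i \<in> Zn n1 \<Longrightarrow> ret1 (inc1 i) = i"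
  by (auto simp: ret1_def inc1_eq)

lemma ret1_inc2 [simp]: "j \<in> Zn n2 \<Longrightarrow> ret1 (inc2 j) = x1"
  by (auto simp: ret1_def inc2_eq)

lemma ret2_inc1 [simp]: "i \<in> Zn n1 \<Longrightarrow> ret2 (inc1 i) = x2"
  by (auto simp: ret2_def inc1_eq)

lemma ret2_inc2 [simp]: "j \<in> Zn n2 \<Longrightarrow> ret2 (inc2 j) = j"
  by (auto simp: ret2_def inc2_eq)

definition vertices :: "(int + int) set set" where
  "vertices = inc1 ` Zn n1 \<union> inc2 ` Zn n2"

definition adjacent :: "(int + int) set \<Rightarrow> (int + int) set \<Rightarrow> bool" where
  "adjacent u v \<longleftrightarrow>
     (\<exists>i\<in>Zn n1. \<exists>j\<in>Zn n1. u = inc1 i \<and> v = inc1 j \<and> near_mod n1 m1 i j) \<or>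
     (\<exists>i\<in>Zn n2. \<exists>j\<in>Zn n2. u = inc2 i \<and> v = inc2 j \<and> near_mod n2 m2 i j)"

lemma adjacent_inc1: "i \<in> Zn n1 \<Longrightarrow> j \<in> Zn n1 \<Longrightarrow> near_mod n1 m1 i j \<Longrightarrow> adjacent (inc1 i) (inc1 j)"
  and adjacent_inc2: "i \<in> Zn n2 \<Longrightarrow> j \<in> Zn n2 \<Longrightarrow> near_mod n2 m2 i j \<Longrightarrow> adjacent (inc2 i) (inc2 j)"
  by (auto simp: adjacent_def)

lemma wedge_cspace_eq_graph_cspace:
  "wedge_cspace (Zn_cspace n1 m1) x1 (Zn_cspace n2 m2) x2 = graph_cspace vertices adjacent"
proof -
  let ?X = "Inl ` Zn n1 \<union> Inr ` Zn n2 :: (int + int) set"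
  let ?r = "wedge_rel (Zn n1) x1 (Zn n2) x2"
  have carrier: "?X // ?r = vertices"
    unfolding quotient_def vertices_def inc1_def inc2_def by auto
  have closure: "(\<lambda>x. ?r `` {x}) ` (Inl ` Zn_closure n1 m1 (Inl -` {x \<in> ?X. ?r `` {x} \<in> A}) \<union>
      Inr ` Zn_closure n2 m2 (Inr -` {x \<in> ?X. ?r `` {x} \<in> A})) =
    {v \<in> vertices. \<exists>u \<in> A \<inter> vertices. adjacent u v}" (is "?L = ?R") for A
  proof -
    have pre: "Inl -` {x \<in> ?X. ?r `` {x} \<in> A} = {i \<in> Zn n1. inc1 i \<in> A}"
      "Inr -` {x \<in> ?X. ?r `` {x} \<in> A} = {i \<in> Zn n2. inc2 i \<in> A}"
      by (auto simp: inc1_def inc2_def)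
    have "?L = inc1 ` {j \<in> Zn n1. \<exists>i\<in>Zn n1. inc1 i \<in> A \<and> near_mod n1 m1 i j} \<union>
        inc2 ` {j \<in> Zn n2. \<exists>i\<in>Zn n2. inc2 i \<in> A \<and> near_mod n2 m2 i j}"
      unfolding pre image_Un image_image Zn_closure_def Zn_dist_le_iff
        inc1_def[symmetric] inc2_def[symmetric]
      by (intro arg_cong2[where f = "(\<union>)"] arg_cong2[where f = image]) auto
    also have "\<dots> = ?R" (is "?M = _")
    proof
      show "?M \<subseteq> ?R"
        by (auto simp: vertices_def intro: adjacent_inc1 adjacent_inc2)
      show "?R \<subseteq> ?M"
      proof
        fix v assume "v \<in> ?R"
        then obtain u where "u \<in> A" "adjacent u v" by blast
        then show "v \<in> ?M" unfolding adjacent_def by (elim disjE bexE conjE) auto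
      qed
    qed
    finally show ?thesis .
  qed
  show ?thesis
    unfolding wedge_cspace_def quotient_cspace_def disjoint_union_cspace_def Zn_cspace_def
      graph_cspace_def Let_def prod.case fst_conv
    using carrier closure by simp
qed

sublocale reflexive_graph vertices adjacent
proof
  show "finite vertices" by (simp add: vertices_def Zn_def)
  show "u \<in> vertices" "adjacent v u" if "adjacent u v" for u v
    using that near_mod_sym unfolding vertices_def adjacent_def by blast+
  show "adjacent v v" if "v \<in> vertices" for v
    using that near_mod_refl unfolding vertices_def adjacent_def by blast
qed

text \<open>The two cycles as infinite periodic sequences starting at the base point.\<close>

definition vertex1 :: "nat \<Rightarrow> (int + int) set" where
  "vertex1 l = inc1 (cycle_vertex n1 x1 l)"

definition vertex2 :: "nat \<Rightarrow> (int + int) set" where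
  "vertex2 l = inc2 (cycle_vertex n2 x2 l)"

abbreviation "turn1 \<equiv> walk vertex1 n1"
abbreviation "turn2 \<equiv> walk vertex2 n2"

lemma vertex1_periodic: "vertex1 (n1 + l) = vertex1 l"
  and vertex2_periodic: "vertex2 (n2 + l) = vertex2 l"
  by (simp_all add: vertex1_def vertex2_def cycle_vertex_periodic)

lemma ret_vertex1 [simp]: "ret1 (vertex1 l) = cycle_vertex n1 x1 l" "ret2 (vertex1 l) = x2"
  and ret_vertex2 [simp]: "ret1 (vertex2 l) = x1" "ret2 (vertex2 l) = cycle_vertex n2 x2 l"
  using x1 x2 by (simp_all add: vertex1_def vertex2_def cycle_vertex_in_Zn)

lemma near_mod_cycle_vertex: "d \<le> m \<Longrightarrow> near_mod n m (cycle_vertex n x l) (cycle_vertex n x (l + d))"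
  unfolding near_mod_def by (intro exI[of _ "int d"]) (simp add: cycle_vertex_cong)

lemma adjacent_vertex1: "d \<le> m1 \<Longrightarrow> adjacent (vertex1 l) (vertex1 (l + d))"
  using x1 by (simp add: vertex1_def adjacent_inc1 cycle_vertex_in_Zn near_mod_cycle_vertex)

lemma adjacent_vertex2: "d \<le> m2 \<Longrightarrow> adjacent (vertex2 l) (vertex2 (l + d))"
  using x2 by (simp add: vertex2_def adjacent_inc2 cycle_vertex_in_Zn near_mod_cycle_vertex)

lemma adjacentE:
  assumes "adjacent u v"
  obtains l d where "d \<le> m1" "u = vertex1 l \<and> v = vertex1 (l + d) \<or> v = vertex1 l \<and> u = vertex1 (l + d)"
  | l d where "d \<le> m2" "u = vertex2 l \<and> v = vertex2 (l + d) \<or> v = vertex2 l \<and> u = vertex2 (l + d)"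
  using assms unfolding adjacent_def
proof (elim disjE bexE conjE)
  fix i j assume *: "i \<in> Zn n1" "j \<in> Zn n1" "u = inc1 i" "v = inc1 j" "near_mod n1 m1 i j"
  show thesis
    using near_mod_cycle_vertexE[OF x1 *(1,2,5)] that(1) unfolding vertex1_def *(3,4) by metis
next
  fix i j assume *: "i \<in> Zn n2" "j \<in> Zn n2" "u = inc2 i" "v = inc2 j" "near_mod n2 m2 i j"
  show thesis
    using near_mod_cycle_vertexE[OF x2 *(1,2,5)] that(2) unfolding vertex2_def *(3,4) by metis
qed

text \<open>Every vertex is joined to the base point by the walk that goes forward in its own cycle; the
  retractions read off the number of steps, which is zero in the other cycle.\<close>

lemma cycles_generated_by_turns:
  assumes "z \<in> ccycles 1 space"
  shows "\<exists>a b. z - (frag_cmul a turn1 + frag_cmul b turn2) \<in> cboundaries 1 space"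
proof -
  \<comment> \<open>At every vertex at most one of the two summands is not the empty walk.\<close>
  define P where "P u = walk vertex1 (nat ((ret1 u - x1) mod int n1)) + walk vertex2 (nat ((ret2 u - x2) mod int n2))"
    for u
  define H where "H = {z. \<exists>a b. z - (frag_cmul a turn1 + frag_cmul b turn2) \<in> cboundaries 1 space}"
  have P1: "P (vertex1 l) = walk vertex1 (l mod n1)" and P2: "P (vertex2 l) = walk vertex2 (l mod n2)" for l
    using x1 x2 by (simp_all add: P_def cycle_vertex_index)
  have diff: "x - y \<in> H" if xy: "x \<in> H" "y \<in> H" for x y
  proof -
    obtain a b a' b' where
      "x - (frag_cmul a turn1 + frag_cmul b turn2) \<in> cboundaries 1 space"
      "y - (frag_cmul a' turn1 + frag_cmul b' turn2) \<in> cboundaries 1 space"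
      using xy unfolding H_def by blast
    from cboundaries_diff[OF this]
    have "(x - y) - (frag_cmul (a - a') turn1 + frag_cmul (b - b') turn2) \<in> cboundaries 1 space"
      by (simp add: algebra_simps frag_cmul_diff_distrib)
    then show ?thesis unfolding H_def by blast
  qed
  have bd: "cboundaries 1 space \<subseteq> H"
  proof
    fix x assume "x \<in> cboundaries 1 space"
    then have "x - (frag_cmul 0 turn1 + frag_cmul 0 turn2) \<in> cboundaries 1 space" by simp
    then show "x \<in> H" unfolding H_def by blast
  qed
  have "turn1 - (frag_cmul 1 turn1 + frag_cmul 0 turn2) \<in> cboundaries 1 space"
    and "turn2 - (frag_cmul 0 turn1 + frag_cmul 1 turn2) \<in> cboundaries 1 space"
    by (simp_all add: cboundaries_zero)
  then have turns: "turn1 \<in> H" "turn2 \<in> H" unfolding H_def by blast+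
  have "z \<in> H"
  proof (rule cycles_generated_by_edges[OF diff bd _ assms])
    fix u v assume "adjacent u v"
    then show "P u + edge u v - P v \<in> H"
    proof (cases rule: adjacentE)
      case (1 l d)
      then show ?thesis
        using closed_up_edge[OF diff bd turns(1) vertex1_periodic adjacent_vertex1, of m1 P] P1 by blast
    next
      case (2 l d)
      then show ?thesis
        using closed_up_edge[OF diff bd turns(2) vertex2_periodic adjacent_vertex2, of m2 P] P2 by blast
    qed
  qed
  then show ?thesis unfolding H_def by blast
qed

lemma graph_over_cycle1: "3 * m1 < n1 \<Longrightarrow> graph_over_cycle vertices adjacent n1 m1 ret1"
  by unfold_locales (auto simp: adjacent_def near_mod_refl)

lemma graph_over_cycle2: "3 * m2 < n2 \<Longrightarrow> graph_over_cycle vertices adjacent n2 m2 ret2"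
  by unfold_locales (auto simp: adjacent_def near_mod_refl)

lemma turn1_in_ccycles: "1 \<le> m1 \<Longrightarrow> turn1 \<in> ccycles 1 space"
  using closed_walk_in_ccycles[of n1 vertex1] adjacent_vertex1[of 1] vertex1_periodic[of 0]
  by (simp add: Suc_eq_plus1)

lemma turn2_in_ccycles: "1 \<le> m2 \<Longrightarrow> turn2 \<in> ccycles 1 space"
  using closed_walk_in_ccycles[of n2 vertex2] adjacent_vertex2[of 1] vertex2_periodic[of 0]
  by (simp add: Suc_eq_plus1)

text \<open>A complete cycle is a clique, in which every closed walk bounds.\<close>

lemma turn1_in_cboundaries: "n1 div 2 \<le> m1 \<Longrightarrow> turn1 \<in> cboundaries 1 space"
  using vertex1_periodic[of 0] n1_pos x1
  by (intro closed_walk_in_clique)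
    (simp_all add: vertex1_def adjacent_inc1 cycle_vertex_in_Zn near_mod_total)

lemma turn2_in_cboundaries: "n2 div 2 \<le> m2 \<Longrightarrow> turn2 \<in> cboundaries 1 space"
  using vertex2_periodic[of 0] n2_pos x2
  by (intro closed_walk_in_clique)
    (simp_all add: vertex2_def adjacent_inc2 cycle_vertex_in_Zn near_mod_total)

lemma winding_turns1:
  assumes "1 \<le> m1" "3 * m1 < n1"
  shows "winding n1 m1 ret1 turn1 = int n1" "winding n1 m1 ret1 turn2 = 0"
  using winding_walk[of m1 n1 1 ret1 vertex1 n1] winding_walk[of m1 n1 0 ret1 vertex2 n2] assms
    cycle_vertex_cong[of n1 x1 _ 1]
  by (simp_all add: Suc_eq_plus1)

lemma winding_turns2:
  assumes "1 \<le> m2" "3 * m2 < n2"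
  shows "winding n2 m2 ret2 turn1 = 0" "winding n2 m2 ret2 turn2 = int n2"
  using winding_walk[of m2 n2 0 ret2 vertex1 n1] winding_walk[of m2 n2 1 ret2 vertex2 n2] assms
    cycle_vertex_cong[of n2 x2 _ 1]
  by (simp_all add: Suc_eq_plus1)

lemma chomology_group_two_cycles:
  assumes "1 \<le> m1" "3 * m1 < n1" "1 \<le> m2" "3 * m2 < n2"
  shows "chomology_group 1 space \<cong> integer_group \<times>\<times> integer_group"
  by (rule chomology_group_free_rank_2[OF graph_over_cycle1 graph_over_cycle2 turn1_in_ccycles
        turn2_in_ccycles winding_turns1 winding_turns2 cycles_generated_by_turns]) (use assms in auto)

lemma chomology_group_first_cycle:
  assumes "1 \<le> m1" "3 * m1 < n1" "n2 div 2 \<le> m2"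
  shows "chomology_group 1 space \<cong> integer_group"
proof (rule graph_over_cycle.chomology_group_infinite_cyclic[OF graph_over_cycle1 turn1_in_ccycles])
  fix z assume "z \<in> ccycles 1 space"
  then obtain a b where "z - (frag_cmul a turn1 + frag_cmul b turn2) \<in> cboundaries 1 space"
    using cycles_generated_by_turns by blast
  from cboundaries_add[OF this cboundaries_cmul[OF turn2_in_cboundaries[OF assms(3)]], of b]
  show "\<exists>a. z - frag_cmul a turn1 \<in> cboundaries 1 space"
    by (auto simp: algebra_simps)
qed (use assms winding_turns1 in auto)

lemma chomology_group_second_cycle:
  assumes "1 \<le> m2" "3 * m2 < n2" "n1 div 2 \<le> m1"
  shows "chomology_group 1 space \<cong> integer_group"
proof (rule graph_over_cycle.chomology_group_infinite_cyclic[OF graph_over_cycle2 turn2_in_ccycles])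
  fix z assume "z \<in> ccycles 1 space"
  then obtain a b where "z - (frag_cmul a turn1 + frag_cmul b turn2) \<in> cboundaries 1 space"
    using cycles_generated_by_turns by blast
  from cboundaries_add[OF this cboundaries_cmul[OF turn1_in_cboundaries[OF assms(3)]], of a]
  show "\<exists>a. z - frag_cmul a turn2 \<in> cboundaries 1 space"
    by (auto simp: algebra_simps)
qed (use assms winding_turns2 in auto)

lemma chomology_group_no_cycle:
  assumes "n1 div 2 \<le> m1" "n2 div 2 \<le> m2"
  shows "trivial_group (chomology_group 1 space)"
proof (rule chomology_group_trivial)
  fix z assume "z \<in> ccycles 1 space"
  then obtain a b where "z - (frag_cmul a turn1 + frag_cmul b turn2) \<in> cboundaries 1 space"
    using cycles_generated_by_turns by blast
  from cboundaries_add[OF this cboundaries_add[OF cboundaries_cmul[OF turn1_in_cboundaries[OF assms(1)]]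
        cboundaries_cmul[OF turn2_in_cboundaries[OF assms(2)]]], of a b]
  show "z \<in> cboundaries 1 space" by simp
qed

end

theorem theorem5p10:
  fixes n1 n2 m1 m2 :: nat and x1 x2 :: int
  assumes "n1 \<ge> 1" and "n2 \<ge> 1"
    and "x1 \<in> Zn n1" and "x2 \<in> Zn n2"
  defines "X \<equiv> wedge_cspace (Zn_cspace n1 m1) x1 (Zn_cspace n2 m2) x2"
    and "a \<equiv> \<lambda>(n::nat) (m::nat). 3 \<le> 3 * m \<and> 3 * m < n"
    and "b \<equiv> \<lambda>(n::nat) (m::nat). n div 2 \<le> m \<or> (n = 3 \<and> 1 \<le> m)"
  shows "(a n1 m1 \<and> a n2 m2 \<longrightarrow> chomology_group 1 X \<cong> integer_group \<times>\<times> integer_group) \<and>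
         ((a n1 m1 \<and> b n2 m2) \<or> (a n2 m2 \<and> b n1 m1) \<longrightarrow> chomology_group 1 X \<cong> integer_group) \<and>
         (b n1 m1 \<and> b n2 m2 \<longrightarrow> trivial_group (chomology_group 1 X))"
proof -
  interpret cycle_wedge n1 n2 m1 m2 x1 x2
    using assms(3,4) by unfold_locales
  have X: "X = space"
    unfolding X_def by (rule wedge_cspace_eq_graph_cspace)
  have a: "1 \<le> m" "3 * m < n" if "a n m" for n m
    using that by (auto simp: a_def)
  have b: "n div 2 \<le> m" if "b n m" for n m
    using that by (auto simp: b_def)
  show ?thesis
    unfolding X
    using chomology_group_two_cycles chomology_group_first_cycle chomology_group_second_cycle
      chomology_group_no_cycle a b by blast
qed

end
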